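(* Let $K$ be a perfect field over $\mathbb{F}_q$, $r>0$, $\bar K$ an algebraic closure of $K$ and $\bar{\mathbb{F}}$ the algebraic closure of $\mathbb{F}_q$ in $\bar K$. Let $\iota\colon F\to\bar{\mathbb{F}}((\tau^{-1}))$ and $\phi\colon F\to K((\tau^{-1}))$ be continuous ring homomorphisms with $v_{\tau^{-1}}(\iota(z))=v_{\tau^{-1}}(\phi(z))=rd$. Let $D_\iota$ be the centralizer of $\iota(F)$ in $\bar{\mathbb{F}}((\tau^{-1}))$, let $J=V(\iota)$, $V=V(\phi)$, $D=\operatorname{End}J$ identified with $D_\iota^{\mathrm{op}}$ via $\alpha\mapsto(y\mapsto y\alpha)$, and $Y_\iota=\{u\in\bar K((\tau^{-1}))^\times : \iota(x)=u\phi(x)u^{-1}\ \forall x\in F\}$ with $W_K$ acting by $\gamma\cdot u=\tau^{\operatorname{ord}\gamma}\gamma_\tau(u)$ and $D_\iota^\times$ acting by left multiplication. Then the map $Y_\iota\to T(V)\setminus\{0\}$, $u\mapsto(y\mapsto yu)$, is a $W_K$-equivariant bijection transforming the left action of $D_\iota^\times$ into the right action of $D^\times$.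
   Context: $F$ is a local field over $\mathbb{F}_q$ with uniformizer $z$ and $d$ the degree of its residue field over $\mathbb{F}_q$. For a perfect field $L$, $L((\tau^{-1}))$ is the skew field of Laurent series in $\tau^{-1}$ with finite principal parts and $\alpha\tau^{-1}=\tau^{-1}\alpha^q$ ($\alpha\in L$), with $\tau^{-1}$-adic topology; $v_{\tau^{-1}}$ is its normalized valuation. For a continuous homomorphism $\psi\colon F\to L((\tau^{-1}))$, $V(\psi)$ is $L((\tau^{-1}))$ as a left $L((\tau^{-1}))\otimes_{\mathbb{F}_q}F$-module via $(\alpha\otimes x)\cdot w=\alpha w\psi(x)$. For an automorphism $\gamma$ of $\bar K$, $\gamma_\tau$ is the coefficientwise automorphism of $\bar K((\tau^{-1}))$. $\operatorname{ord}\colon\operatorname{Gal}(\bar K/K)\to\hat{\mathbb{Z}}$ is restriction to $\bar{\mathbb{F}}$, identifying $\operatorname{Gal}(\bar{\mathbb{F}}/\mathbb{F}_q)$ with $\hat{\mathbb{Z}}$ via the geometric Frobenius; $W_K=\operatorname{ord}^{-1}(\mathbb{Z})$. With $\bar V=\bar K((\tau^{-1}))\otimes_{K((\tau^{-1}))}V$ (identified with $\bar K((\tau^{-1}))$), $T(V)=\operatorname{Hom}_{\bar{\mathbb{F}}((\tau^{-1}))\otimes_{\mathbb{F}_q}F}(J,\bar V)$, with right $D$-action by precomposition and $\gamma\in W_K$ acting by $\gamma(f)(y)=(\gamma_\tau\otimes\mathrm{id})(f(\tau^{\operatorname{ord}\gamma}y))$. *)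

theory Defs
  imports
    "HOL-Library.Cardinality"
    "HOL-Analysis.Abstract_Limits"
    "HOL-Algebra.Embedded_Algebras"
    "HOL-Algebra.QuotRing"
    "HOL-Algebra.Algebraic_Closure_Type"
begin

definition q_num :: "'e::finite itself \<Rightarrow> 'a::semiring_1 itself \<Rightarrow> nat"
  where "q_num _ _ = CHAR('a) ^ CARD('e)"

definition frob :: "'e::finite itself \<Rightarrow> int \<Rightarrow> 'a::field \<Rightarrow> 'a"
  where "frob E i = (if 0 \<le> i then (\<lambda>x. x ^ (q_num E TYPE('a) ^ nat i))
                     else inv_into UNIV (\<lambda>x. x ^ (q_num E TYPE('a) ^ nat (- i))))"

lemma q_num_gt_1: "q_num E TYPE('a::field_prime_char) > 1"
proof -
  have "CHAR('a) > 1" by (rule prime_gt_1_nat[OF CHAR_prime])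
  thus ?thesis unfolding q_num_def by (rule one_less_power) simp
qed

lemma q_num_power_add:
  fixes x y :: "'a::field_prime_char" and E :: "'e::finite itself"
  shows "(x + y) ^ (q_num E TYPE('a) ^ n) = x ^ (q_num E TYPE('a) ^ n) + y ^ (q_num E TYPE('a) ^ n)"
proof (rule freshmans_dream')
  show "q_num E TYPE('a) ^ n = CHAR('a) ^ (CARD('e) * n)"
    by (simp only: q_num_def power_mult)
qed (rule CHAR_prime)

lemma q_num_power_inj:
  fixes x y :: "'a::field_prime_char"
  assumes "x ^ (q_num E TYPE('a) ^ n) = y ^ (q_num E TYPE('a) ^ n)"
  shows "x = y"
proof -
  have "x ^ (q_num E TYPE('a) ^ n) = ((x - y) + y) ^ (q_num E TYPE('a) ^ n)" by simp
  also have "\<dots> = (x - y) ^ (q_num E TYPE('a) ^ n) + y ^ (q_num E TYPE('a) ^ n)"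
    by (rule q_num_power_add)
  finally show ?thesis using assms by simp
qed

lemma frob_neg:
  fixes x :: "'a::{alg_closed_field, field_prime_char}"
  assumes "i < 0"
  shows "frob E i x ^ (q_num E TYPE('a) ^ nat (- i)) = x"
proof -
  have "q_num E TYPE('a) > 0" using q_num_gt_1[of E, where 'a='a] by linarith
  then have "\<exists>y::'a. y ^ (q_num E TYPE('a) ^ nat (- i)) = x"
    by (intro nth_root_exists) simp
  hence "x \<in> range (\<lambda>x::'a. x ^ (q_num E TYPE('a) ^ nat (- i)))" by blast
  from f_inv_into_f[OF this] show ?thesis using assms by (simp only: frob_def) simp
qed

lemma frob_power:
  fixes x :: "'a::{alg_closed_field, field_prime_char}"
  assumes "i + int n \<ge> 0"
  shows "frob E i x ^ (q_num E TYPE('a) ^ n) = x ^ (q_num E TYPE('a) ^ nat (i + int n))"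
proof (cases "i \<ge> 0")
  case True
  thus ?thesis by (simp only: frob_def nat_add_distrib power_add if_True nat_int power_mult[symmetric] of_nat_0_le_iff)
next
  case False
  define m where "m = nat (i + int n)"
  have n: "n = nat (- i) + m" using assms False by (simp add: m_def)
  show ?thesis using frob_neg[of i E x] False
    by (simp only: n power_add power_mult m_def[symmetric]) (simp add: not_le)
qed

lemma frob_eqI:
  fixes x :: "'a::{alg_closed_field, field_prime_char}"
  assumes "y ^ (q_num E TYPE('a) ^ n) = x ^ (q_num E TYPE('a) ^ nat (i + int n))" "i + int n \<ge> 0"
  shows "frob E i x = y"
  by (rule q_num_power_inj[of _ E n]) (simp add: frob_power assms)

lemma frob_frob:
  fixes x :: "'a::{alg_closed_field, field_prime_char}"
  shows "frob E i (frob E j x) = frob E (i + j) x"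
proof -
  define N where "N = nat \<bar>i\<bar> + nat \<bar>j\<bar>"
  have N: "int N = \<bar>i\<bar> + \<bar>j\<bar>" by (simp add: N_def)
  show ?thesis
  proof (rule frob_eqI[where n = N])
    show iN: "i + int N \<ge> 0" using N by linarith
    have 1: "i + j + int N \<ge> 0" using N by linarith
    have 2: "j + int (nat (i + int N)) \<ge> 0" using 1 by (subst int_nat_eq) (simp add: iN)
    from 1 2 show "frob E (i + j) x ^ (q_num E TYPE('a) ^ N) = frob E j x ^ (q_num E TYPE('a) ^ nat (i + int N))"
      using iN by (simp only: frob_power nat_0_le) (simp add: add_ac)
  qed
qed

lemma frob_0 [simp]: "frob E 0 x = x"
  by (simp add: frob_def)

lemma frob_add:
  fixes x :: "'a::{alg_closed_field, field_prime_char}"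
  shows "frob E i (x + y) = frob E i x + frob E i y"
  by (rule frob_eqI[where n = "nat \<bar>i\<bar>"]) (auto simp: q_num_power_add frob_power)

lemma frob_mult:
  fixes x :: "'a::{alg_closed_field, field_prime_char}"
  shows "frob E i (x * y) = frob E i x * frob E i y"
  by (rule frob_eqI[where n = "nat \<bar>i\<bar>"]) (auto simp: power_mult_distrib frob_power)

lemma frob_of_1 [simp]: "frob E i (1::'a::{alg_closed_field, field_prime_char}) = 1"
  by (rule frob_eqI[where n = "nat \<bar>i\<bar>"]) auto

lemma frob_of_0 [simp]: "frob E i (0::'a::{alg_closed_field, field_prime_char}) = 0"
  using frob_add[of E i 0 0] by (metis add.right_neutral add_left_cancel)

lemma frob_sum:
  fixes f :: "'b \<Rightarrow> 'a::{alg_closed_field, field_prime_char}"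
  shows "frob E i (sum f A) = (\<Sum>x\<in>A. frob E i (f x))"
  by (induction A rule: infinite_finite_induct) (auto simp: frob_add)


typedef (overloaded) ('e, 'a) tau_laurent =
  "{f :: int \<Rightarrow> 'a::zero. \<exists>N. \<forall>n<N. f n = 0}"
  morphisms tau_nth Abs_tau_laurent
  by (rule exI[of _ "\<lambda>_. 0"]) auto

setup_lifting type_definition_tau_laurent

lemma tau_eqI: "(\<And>n. tau_nth f n = tau_nth g n) \<Longrightarrow> f = g"
  by transfer auto

lemma tau_bound: "\<exists>N. \<forall>n<N. tau_nth f n = 0"
  by transfer auto

instantiation tau_laurent :: (type, ab_group_add) ab_group_add
begin
lift_definition zero_tau_laurent :: "('a, 'b) tau_laurent" is "\<lambda>_. 0" by auto
lift_definition plus_tau_laurent :: "('a, 'b) tau_laurent \<Rightarrow> ('a, 'b) tau_laurent \<Rightarrow> ('a, 'b) tau_laurent"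
  is "\<lambda>f g n. f n + g n"
proof -
  fix f g :: "int \<Rightarrow> 'b"
  assume "\<exists>N. \<forall>n<N. f n = 0" "\<exists>N. \<forall>n<N. g n = 0"
  then obtain M N where "\<forall>n<M. f n = 0" "\<forall>n<N. g n = 0" by auto
  thus "\<exists>N. \<forall>n<N. f n + g n = 0" by (intro exI[of _ "min M N"]) auto
qed
lift_definition uminus_tau_laurent :: "('a, 'b) tau_laurent \<Rightarrow> ('a, 'b) tau_laurent"
  is "\<lambda>f n. - f n" by auto
definition minus_tau_laurent :: "('a, 'b) tau_laurent \<Rightarrow> ('a, 'b) tau_laurent \<Rightarrow> ('a, 'b) tau_laurent"
  where "minus_tau_laurent f g = f + (- g)"
instance
  by standard (transfer; simp add: add_ac fun_eq_iff; fail | simp add: minus_tau_laurent_def)+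
end

lemma tau_nth_simps [simp]:
  "tau_nth 0 n = 0" "tau_nth (f + g) n = tau_nth f n + tau_nth g n"
  "tau_nth (- f) n = - tau_nth f n" "tau_nth (f - g) n = tau_nth f n - tau_nth g n"
  unfolding minus_tau_laurent_def by (transfer; simp)+

lift_definition tau_monom :: "'a::zero \<Rightarrow> int \<Rightarrow> ('e, 'a) tau_laurent"
  is "\<lambda>c k n. if n = k then c else 0"
  by (metis less_irrefl)

lemma tau_nth_monom [simp]: "tau_nth (tau_monom c k) n = (if n = k then c else 0)"
  by transfer auto

lemma finite_conv_support:
  fixes f g :: "int \<Rightarrow> 'a::zero"
  assumes "\<forall>n<M. f n = 0" "\<forall>n<N. g n = 0"
  shows "{i. f i \<noteq> 0 \<and> g (n - i) \<noteq> 0} \<subseteq> {M..n - N}"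
  using assms by (force simp: not_less[symmetric])

lemma sum_shift_int:
  "(\<Sum>k\<in>{A..B}. F (k - i)) = (\<Sum>j\<in>{A - i..B - i :: int}. F j :: 'b::comm_monoid_add)"
  by (rule sum.reindex_bij_witness[of _ "\<lambda>j. j + i" "\<lambda>k. k - i"]) simp_all

instantiation tau_laurent :: (finite, "{alg_closed_field, field_prime_char}") ring_1
begin

lift_definition one_tau_laurent :: "('a, 'b) tau_laurent" is "\<lambda>n. if n = 0 then 1 else 0"
  by (metis less_irrefl)

lift_definition times_tau_laurent ::
    "('a, 'b) tau_laurent \<Rightarrow> ('a, 'b) tau_laurent \<Rightarrow> ('a, 'b) tau_laurent"
  is "\<lambda>f g n. \<Sum>i | f i \<noteq> 0 \<and> g (n - i) \<noteq> 0. f i * frob TYPE('a) (- i) (g (n - i))"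
proof -
  fix f g :: "int \<Rightarrow> 'b"
  assume "\<exists>N. \<forall>n<N. f n = 0" "\<exists>N. \<forall>n<N. g n = 0"
  then obtain M N where MN: "\<forall>n<M. f n = 0" "\<forall>n<N. g n = 0" by auto
  have "(\<Sum>i | f i \<noteq> 0 \<and> g (n - i) \<noteq> 0. f i * frob TYPE('a) (- i) (g (n - i))) = 0" if "n < M + N" for n
  proof -
    have "{i. f i \<noteq> 0 \<and> g (n - i) \<noteq> 0} = {}"
      using finite_conv_support[OF MN, of n] that by auto
    thus ?thesis by (simp only: sum.empty)
  qed
  thus "\<exists>N. \<forall>n<N. (\<Sum>i | f i \<noteq> 0 \<and> g (n - i) \<noteq> 0. f i * frob TYPE('a) (- i) (g (n - i))) = 0"
    by blast
qed

lemma tau_nth_times: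
  fixes f g :: "('a, 'b) tau_laurent"
  shows "tau_nth (f * g) n =
    (\<Sum>i | tau_nth f i \<noteq> 0 \<and> tau_nth g (n - i) \<noteq> 0. tau_nth f i * frob TYPE('a) (- i) (tau_nth g (n - i)))"
  by transfer auto

lemma tau_nth_times_superset:
  fixes f g :: "('a, 'b) tau_laurent"
  assumes "\<forall>n<M. tau_nth f n = 0" "\<forall>n<N. tau_nth g n = 0" "{M..n - N} \<subseteq> A" "finite A"
  shows "tau_nth (f * g) n = (\<Sum>i\<in>A. tau_nth f i * frob TYPE('a) (- i) (tau_nth g (n - i)))"
  unfolding tau_nth_times
  using finite_conv_support[OF assms(1,2), of n] assms(3,4)
  by (intro sum.mono_neutral_left) auto

lemma tau_nth_1 [simp]: "tau_nth (1::('a, 'b) tau_laurent) n = (if n = 0 then 1 else 0)"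
  by transfer auto

instance
proof
  fix f g h :: "('a, 'b) tau_laurent"
  let ?q = "frob TYPE('a) :: int \<Rightarrow> 'b \<Rightarrow> 'b"
  obtain a where a: "\<forall>n<a. tau_nth f n = 0" using tau_bound by blast
  obtain b where b: "\<forall>n<b. tau_nth g n = 0" using tau_bound by blast
  obtain c where c: "\<forall>n<c. tau_nth h n = 0" using tau_bound by blast
  have bd: "\<forall>n<M + N. tau_nth (u * w) n = 0"
    if "\<forall>n<M. tau_nth u n = 0" "\<forall>n<N. tau_nth w n = 0" for M N and u w :: "('a, 'b) tau_laurent"
    using tau_nth_times_superset[OF that order.refl] by auto
  show "f * g * h = f * (g * h)"
  proof (rule tau_eqI)
    fix n
    define F where "F i j = tau_nth f i * ?q (- i) (tau_nth g j) * ?q (- i - j) (tau_nth h (n - i - j))" for i j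
    have "tau_nth (f * g * h) n = (\<Sum>k\<in>{a+b..n-c}. tau_nth (f * g) k * ?q (- k) (tau_nth h (n - k)))"
      by (rule tau_nth_times_superset[OF bd[OF a b] c]) auto
    also have "\<dots> = (\<Sum>k\<in>{a+b..n-c}. \<Sum>i\<in>{a..n-b-c}. F i (k - i))"
    proof (rule sum.cong[OF refl])
      fix k assume k: "k \<in> {a+b..n-c}"
      have "tau_nth (f * g) k = (\<Sum>i\<in>{a..n-b-c}. tau_nth f i * ?q (- i) (tau_nth g (k - i)))"
        by (rule tau_nth_times_superset[OF a b]) (use k in auto)
      thus "tau_nth (f * g) k * ?q (- k) (tau_nth h (n - k)) = (\<Sum>i\<in>{a..n-b-c}. F i (k - i))"
        by (simp add: F_def sum_distrib_right)
    qed
    also have "\<dots> = (\<Sum>i\<in>{a..n-b-c}. \<Sum>k\<in>{a+b..n-c}. F i (k - i))"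
      by (rule sum.swap)
    also have "\<dots> = (\<Sum>i\<in>{a..n-b-c}. \<Sum>j\<in>{b..n-i-c}. F i j)"
    proof (rule sum.cong[OF refl])
      fix i assume i: "i \<in> {a..n-b-c}"
      have "(\<Sum>k\<in>{a+b..n-c}. F i (k - i)) = (\<Sum>j\<in>{a+b-i..n-c-i}. F i j)"
        by (rule sum_shift_int)
      also have "\<dots> = (\<Sum>j\<in>{b..n-i-c}. F i j)"
        by (rule sum.mono_neutral_right) (use i b in \<open>auto simp: F_def\<close>)
      finally show "(\<Sum>k\<in>{a+b..n-c}. F i (k - i)) = (\<Sum>j\<in>{b..n-i-c}. F i j)" .
    qed
    also have "\<dots> = (\<Sum>i\<in>{a..n-b-c}. tau_nth f i * ?q (- i) (tau_nth (g * h) (n - i)))"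
    proof (rule sum.cong[OF refl])
      fix i
      have "tau_nth (g * h) (n - i) = (\<Sum>j\<in>{b..n-i-c}. tau_nth g j * ?q (- j) (tau_nth h (n - i - j)))"
        by (rule tau_nth_times_superset[OF b c]) auto
      thus "(\<Sum>j\<in>{b..n-i-c}. F i j) = tau_nth f i * ?q (- i) (tau_nth (g * h) (n - i))"
        by (simp add: F_def frob_sum sum_distrib_left frob_mult frob_frob mult.assoc)
    qed
    also have "\<dots> = tau_nth (f * (g * h)) n"
      by (rule tau_nth_times_superset[OF a bd[OF b c], symmetric]) auto
    finally show "tau_nth (f * g * h) n = tau_nth (f * (g * h)) n" .
  qed
  show "1 * f = f"
  proof (rule tau_eqI)
    fix n
    have "tau_nth (1 * f) n = (\<Sum>i\<in>insert 0 {0..n-a}. tau_nth (1::('a,'b) tau_laurent) i * ?q (- i) (tau_nth f (n - i)))"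
      by (rule tau_nth_times_superset[OF _ a]) auto
    also have "\<dots> = (\<Sum>i\<in>{0}. tau_nth (1::('a,'b) tau_laurent) i * ?q (- i) (tau_nth f (n - i)))"
      by (rule sum.mono_neutral_right) auto
    finally show "tau_nth (1 * f) n = tau_nth f n" by simp
  qed
  show "f * 1 = f"
  proof (rule tau_eqI)
    fix n
    have "tau_nth (f * 1) n = (\<Sum>i\<in>insert n {a..n-0}. tau_nth f i * ?q (- i) (tau_nth (1::('a,'b) tau_laurent) (n - i)))"
      by (rule tau_nth_times_superset[OF a]) auto
    also have "\<dots> = (\<Sum>i\<in>{n}. tau_nth f i * ?q (- i) (tau_nth (1::('a,'b) tau_laurent) (n - i)))"
      by (rule sum.mono_neutral_right) auto
    finally show "tau_nth (f * 1) n = tau_nth f n" by simp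
  qed
  show "(f + g) * h = f * h + g * h"
  proof (rule tau_eqI)
    fix n
    let ?m = "min a b"
    have 1: "\<forall>n<?m. tau_nth f n = 0" "\<forall>n<?m. tau_nth g n = 0" "\<forall>n<?m. tau_nth (f + g) n = 0"
      using a b by auto
    show "tau_nth ((f + g) * h) n = tau_nth (f * h + g * h) n"
      by (simp add: tau_nth_times_superset[OF 1(1) c order.refl]
            tau_nth_times_superset[OF 1(2) c order.refl] tau_nth_times_superset[OF 1(3) c order.refl]
            ring_distribs sum.distrib)
  qed
  show "f * (g + h) = f * g + f * h"
  proof (rule tau_eqI)
    fix n
    let ?m = "min b c"
    have 1: "\<forall>n<?m. tau_nth g n = 0" "\<forall>n<?m. tau_nth h n = 0" "\<forall>n<?m. tau_nth (g + h) n = 0"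
      using b c by auto
    show "tau_nth (f * (g + h)) n = tau_nth (f * g + f * h) n"
      by (simp add: tau_nth_times_superset[OF a 1(1) order.refl]
            tau_nth_times_superset[OF a 1(2) order.refl] tau_nth_times_superset[OF a 1(3) order.refl]
            ring_distribs sum.distrib frob_add)
  qed
  have "tau_nth 0 (0::int) \<noteq> tau_nth (1::('a,'b) tau_laurent) 0" by simp
  thus "(0::('a,'b) tau_laurent) \<noteq> 1" by metis
qed

end

fun right_inv_coeff :: "'e::finite itself \<Rightarrow> (int \<Rightarrow> 'a::field) \<Rightarrow> int \<Rightarrow> nat \<Rightarrow> 'a" where
  "right_inv_coeff E a m k = frob E m (((if k = 0 then 1 else 0)
     - (\<Sum>s\<in>{1..k}. a (m + int s) * frob E (- (m + int s)) (right_inv_coeff E a m (k - s)))) / a m)"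

declare right_inv_coeff.simps [simp del]

lemma tau_right_inverse:
  fixes f :: "('e::finite, 'a::{alg_closed_field, field_prime_char}) tau_laurent"
  assumes "f \<noteq> 0"
  shows "\<exists>g. f * g = 1"
proof -
  obtain N where N: "\<forall>n<N. tau_nth f n = 0" using tau_bound by blast
  obtain k where k: "tau_nth f k \<noteq> 0" using assms tau_eqI[of f 0] by auto
  have "k \<ge> N" using N k by force
  define s where "s = (LEAST s. tau_nth f (N + int s) \<noteq> 0)"
  define m where "m = N + int s"
  have ex: "tau_nth f (N + int (nat (k - N))) \<noteq> 0" using k \<open>k \<ge> N\<close> by simp
  have m0: "tau_nth f m \<noteq> 0" unfolding m_def s_def by (rule LeastI[where P = "\<lambda>s. tau_nth f (N + int s) \<noteq> 0", OF ex])
  have m: "\<forall>n<m. tau_nth f n = 0"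
  proof (intro allI impI)
    fix n assume n: "n < m"
    show "tau_nth f n = 0"
    proof (cases "n < N")
      case True thus ?thesis using N by blast
    next
      case False
      hence "nat (n - N) < s" using n by (simp add: m_def)
      from not_less_Least[OF this[unfolded s_def]] show ?thesis using False by simp
    qed
  qed
  define c where "c = right_inv_coeff TYPE('e) (tau_nth f) m"
  define g :: "('e, 'a) tau_laurent" where "g = Abs_tau_laurent (\<lambda>n. if n < - m then 0 else c (nat (n + m)))"
  have g: "tau_nth g n = (if n < - m then 0 else c (nat (n + m)))" for n
    unfolding g_def by (subst Abs_tau_laurent_inverse) auto
  have g0: "\<forall>n<(- m). tau_nth g n = 0" by (simp add: g)
  let ?q = "frob TYPE('e) :: int \<Rightarrow> 'a \<Rightarrow> 'a"
  have "tau_nth (f * g) n = tau_nth 1 n" for n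
  proof (cases "n < 0")
    case True
    thus ?thesis by (simp add: tau_nth_times_superset[OF m g0 order.refl])
  next
    case False
    then obtain k where nk: "n = int k" by (metis nonneg_int_cases not_less)
    have "tau_nth (f * g) n = (\<Sum>i\<in>{m..n - (- m)}. tau_nth f i * ?q (- i) (tau_nth g (n - i)))"
      by (rule tau_nth_times_superset[OF m g0 order.refl]) simp
    also have "\<dots> = (\<Sum>t\<in>{0..k}. tau_nth f (m + int t) * ?q (- (m + int t)) (c (k - t)))"
      by (rule sum.reindex_bij_witness[of _ "\<lambda>t. m + int t" "\<lambda>i. nat (i - m)"])
         (auto simp: nk g nat_diff_distrib intro!: arg_cong[of _ _ c] arg_cong2[of _ _ _ _ "(*)"] arg_cong[of _ _ "?q _"])
    also have "\<dots> = tau_nth f m * ?q (- m) (c k)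
        + (\<Sum>t\<in>{1..k}. tau_nth f (m + int t) * ?q (- (m + int t)) (c (k - t)))"
      by (simp add: sum.atLeast_Suc_atMost)
    also have "?q (- m) (c k) = ((if k = 0 then 1 else 0)
        - (\<Sum>t\<in>{1..k}. tau_nth f (m + int t) * ?q (- (m + int t)) (c (k - t)))) / tau_nth f m"
      unfolding c_def by (subst right_inv_coeff.simps) (simp only: frob_frob, simp)
    finally show ?thesis using m0 by (simp add: nk)
  qed
  hence "f * g = 1" by (rule tau_eqI)
  thus ?thesis ..
qed

instantiation tau_laurent :: (finite, "{alg_closed_field, field_prime_char}") inverse
begin

definition inverse_tau_laurent_def:
  "inverse (f :: ('a, 'b) tau_laurent) = (if f = 0 then 0 else (SOME g. f * g = 1))"

definition divide_tau_laurent_def: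
  "f div (g :: ('a, 'b) tau_laurent) = f * inverse g"

instance ..

end

instance tau_laurent :: (finite, "{alg_closed_field, field_prime_char}") division_ring
proof
  fix f g :: "('a, 'b) tau_laurent"
  have r: "h * inverse h = 1" if "h \<noteq> 0" for h :: "('a, 'b) tau_laurent"
    using someI_ex[OF tau_right_inverse[OF that]] that by (simp add: inverse_tau_laurent_def)
  show "f * inverse f = 1" if "f \<noteq> 0" by (rule r[OF that])
  show "inverse f * f = 1" if f: "f \<noteq> 0"
  proof -
    have i: "inverse f \<noteq> 0" using r[OF f] by force
    have "inverse f * f = inverse f * f * (inverse f * inverse (inverse f))" by (simp add: r[OF i])
    also have "\<dots> = inverse f * (f * inverse f) * inverse (inverse f)" by (simp only: mult.assoc)
    also have "\<dots> = 1" by (simp add: r[OF f] r[OF i])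
    finally show ?thesis .
  qed
  show "f / g = f * inverse g" by (simp add: divide_tau_laurent_def)
  show "inverse (0 :: ('a, 'b) tau_laurent) = 0" by (simp add: inverse_tau_laurent_def)
qed

definition tau :: "('e::finite, 'a::{alg_closed_field, field_prime_char}) tau_laurent"
  where "tau = tau_monom 1 (- 1)"

text \<open>For L perfect, the series over L are closed under the ring operations, and the
  defining relation alpha * inverse tau = inverse tau * alpha ^ q reads as follows.\<close>
lemma tau_monom_mult:
  "tau_monom a m * tau_monom b n =
    (tau_monom (a * frob TYPE('e) (- m) b) (m + n) :: ('e::finite, 'a::{alg_closed_field, field_prime_char}) tau_laurent)"
    (is "?f * ?g = _")
proof (rule tau_eqI)
  fix k
  have "tau_nth (?f * ?g) k = (\<Sum>i\<in>insert m {m..k - n}. tau_nth ?f i * frob TYPE('e) (- i) (tau_nth ?g (k - i)))"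
    by (rule tau_nth_times_superset) auto
  also have "\<dots> = (\<Sum>i\<in>{m}. tau_nth ?f i * frob TYPE('e) (- i) (tau_nth ?g (k - i)))"
    by (rule sum.mono_neutral_right) auto
  finally show "tau_nth (?f * ?g) k = tau_nth (tau_monom (a * frob TYPE('e) (- m) b) (m + n) :: ('e, 'a) tau_laurent) k"
    by auto
qed

lemma inverse_tau: "inverse tau = (tau_monom 1 1 :: ('e::finite, 'a::{alg_closed_field, field_prime_char}) tau_laurent)"
proof (rule inverse_unique)
  show "tau * tau_monom 1 1 = (1 :: ('e, 'a) tau_laurent)"
    unfolding tau_def tau_monom_mult by (rule tau_eqI) simp
qed

lemma tau_commutation:
  fixes \<alpha> :: "'a::{alg_closed_field, field_prime_char}"
  shows "tau_monom \<alpha> 0 * inverse tau =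
    (inverse tau * tau_monom (\<alpha> ^ q_num TYPE('e) TYPE('a)) 0 :: ('e::finite, 'a) tau_laurent)"
proof -
  have "frob TYPE('e) (- 1) (\<alpha> ^ q_num TYPE('e) TYPE('a)) = \<alpha>"
    by (rule frob_eqI[where n = 1]) auto
  thus ?thesis by (simp add: inverse_tau tau_monom_mult)
qed

definition laurent_over :: "'a::{alg_closed_field, field_prime_char} set \<Rightarrow> ('e::finite, 'a) tau_laurent set"
  where "laurent_over L = {f. \<forall>n. tau_nth f n \<in> L}"

definition tau_val :: "('e, 'a::zero) tau_laurent \<Rightarrow> int"
  where "tau_val f = (LEAST n. tau_nth f n \<noteq> 0)"

definition val_topology :: "('r::ab_group_add \<Rightarrow> int) \<Rightarrow> 'r topology"
  where "val_topology v = topology (\<lambda>U. \<forall>x\<in>U. \<exists>n. {y. y = x \<or> n \<le> v (y - x)} \<subseteq> U)"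

lemma openin_val_topology:
  "openin (val_topology v) U \<longleftrightarrow> (\<forall>x\<in>U. \<exists>n. {y. y = x \<or> n \<le> v (y - x)} \<subseteq> U)"
proof -
  have "istopology (\<lambda>U. \<forall>x\<in>U. \<exists>n. {y. y = x \<or> n \<le> v (y - x)} \<subseteq> U)"
    unfolding istopology_def
  proof (intro conjI allI impI ballI)
    fix S T x
    assume "\<forall>x\<in>S. \<exists>n. {y. y = x \<or> n \<le> v (y - x)} \<subseteq> S" "\<forall>x\<in>T. \<exists>n. {y. y = x \<or> n \<le> v (y - x)} \<subseteq> T" "x \<in> S \<inter> T"
    then obtain m n where "{y. y = x \<or> m \<le> v (y - x)} \<subseteq> S" "{y. y = x \<or> n \<le> v (y - x)} \<subseteq> T" by blast
    thus "\<exists>n. {y. y = x \<or> n \<le> v (y - x)} \<subseteq> S \<inter> T" by (intro exI[of _ "max m n"]) auto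
  next
    fix \<K> x
    assume "\<forall>K\<in>\<K>. \<forall>x\<in>K. \<exists>n. {y. y = x \<or> n \<le> v (y - x)} \<subseteq> K" "x \<in> \<Union>\<K>"
    thus "\<exists>n. {y. y = x \<or> n \<le> v (y - x)} \<subseteq> \<Union>\<K>" by (meson UnionE Union_upper order_trans)
  qed
  thus ?thesis by (simp add: val_topology_def topology_inverse')
qed

definition valuation_ring :: "('f::field \<Rightarrow> int) \<Rightarrow> 'f ring"
  where "valuation_ring v = (ring_of_type_algebra :: 'f ring)\<lparr>carrier := {x. x = 0 \<or> 0 \<le> v x}\<rparr>"

definition valuation_ideal :: "('f::field \<Rightarrow> int) \<Rightarrow> 'f set"
  where "valuation_ideal v = {x. x = 0 \<or> 0 < v x}"

definition residue_field :: "('f::field \<Rightarrow> int) \<Rightarrow> 'f set ring"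
  where "residue_field v = valuation_ring v Quot valuation_ideal v"

definition residue_class :: "('f::field \<Rightarrow> int) \<Rightarrow> 'f \<Rightarrow> 'f set"
  where "residue_class v x = valuation_ideal v +>\<^bsub>valuation_ring v\<^esub> x"

definition local_field :: "('f::field \<Rightarrow> int) \<Rightarrow> bool"
  where "local_field v \<longleftrightarrow>
    (\<forall>x y. x \<noteq> 0 \<longrightarrow> y \<noteq> 0 \<longrightarrow> v (x * y) = v x + v y) \<and>
    (\<forall>x y. x \<noteq> 0 \<longrightarrow> y \<noteq> 0 \<longrightarrow> x + y \<noteq> 0 \<longrightarrow> min (v x) (v y) \<le> v (x + y)) \<and>
    (\<forall>n. \<exists>x. x \<noteq> 0 \<and> v x = n) \<and>
    (\<forall>s :: nat \<Rightarrow> 'f. (\<forall>n. \<exists>N. \<forall>i\<ge>N. \<forall>k\<ge>N. s i = s k \<or> n \<le> v (s i - s k))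
       \<longrightarrow> (\<exists>l. limitin (val_topology v) s l sequentially)) \<and>
    finite (carrier (residue_field v))"

definition uniformizer :: "('f::field \<Rightarrow> int) \<Rightarrow> 'f \<Rightarrow> bool"
  where "uniformizer v z \<longleftrightarrow> z \<noteq> 0 \<and> v z = 1"

definition Fq :: "'e::finite itself \<Rightarrow> 'a::{alg_closed_field, field_prime_char} set"
  where "Fq E = {x. x ^ q_num E TYPE('a) = x}"

definition local_field_over ::
    "'e::finite itself \<Rightarrow> ('a::{alg_closed_field, field_prime_char} \<Rightarrow> 'f::field) \<Rightarrow> ('f \<Rightarrow> int) \<Rightarrow> bool"
  where "local_field_over E j v \<longleftrightarrow> local_field v \<and>
    j \<in> ring_hom (ring_of_type_algebra\<lparr>carrier := Fq E\<rparr>) ring_of_type_algebra"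

definition Fbar :: "'e::finite itself \<Rightarrow> 'a::{alg_closed_field, field_prime_char} set"
  where "Fbar E = {x. (ring.algebraic (ring_of_type_algebra :: 'a ring) over Fq E) x}"

definition residue_degree ::
    "'e::finite itself \<Rightarrow> ('a::{alg_closed_field, field_prime_char} \<Rightarrow> 'f::field) \<Rightarrow> ('f \<Rightarrow> int) \<Rightarrow> nat \<Rightarrow> bool"
  where "residue_degree E j v d \<longleftrightarrow>
    ring.dimension (residue_field v) d ((\<lambda>c. residue_class v (j c)) ` Fq E) (carrier (residue_field v))"

definition perfect_in :: "'a::field_prime_char set \<Rightarrow> bool"
  where "perfect_in K \<longleftrightarrow> (\<forall>x\<in>K. \<exists>y\<in>K. y ^ CHAR('a) = x)"

definition continuous_alg_hom ::
    "('a::{alg_closed_field, field_prime_char} \<Rightarrow> 'f::field) \<Rightarrow> ('f \<Rightarrow> int) \<Rightarrow> 'a set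
      \<Rightarrow> ('f \<Rightarrow> ('e::finite, 'a) tau_laurent) \<Rightarrow> bool"
  where "continuous_alg_hom j v L \<psi> \<longleftrightarrow>
    \<psi> \<in> ring_hom ring_of_type_algebra ring_of_type_algebra \<and> (\<forall>c\<in>Fq TYPE('e). \<psi> (j c) = tau_monom c 0) \<and>
    continuous_map (val_topology v) (subtopology (val_topology tau_val) (laurent_over L)) \<psi>"

definition tensor_act ::
    "('f \<Rightarrow> ('e::finite, 'a::{alg_closed_field, field_prime_char}) tau_laurent)
      \<Rightarrow> (('e, 'a) tau_laurent \<times> 'f) list \<Rightarrow> ('e, 'a) tau_laurent \<Rightarrow> ('e, 'a) tau_laurent"
  where "tensor_act \<psi> t w = (\<Sum>(\<alpha>, x)\<leftarrow>t. \<alpha> * w * \<psi> x)"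

definition tensor_hom ::
    "('e::finite, 'a::{alg_closed_field, field_prime_char}) tau_laurent set
      \<Rightarrow> ('e, 'a) tau_laurent set \<Rightarrow> ('f \<Rightarrow> ('e, 'a) tau_laurent)
      \<Rightarrow> ('e, 'a) tau_laurent set \<Rightarrow> ('f \<Rightarrow> ('e, 'a) tau_laurent)
      \<Rightarrow> (('e, 'a) tau_laurent \<Rightarrow> ('e, 'a) tau_laurent) set"
  where "tensor_hom A M \<psi> N \<chi> = {f \<in> M \<rightarrow>\<^sub>E N.
    (\<forall>y\<in>M. \<forall>y'\<in>M. f (y + y') = f y + f y') \<and>
    (\<forall>t\<in>lists (A \<times> UNIV). \<forall>y\<in>M. f (tensor_act \<psi> t y) = tensor_act \<chi> t (f y))}"

definition Jmod :: "('e::finite, 'a::{alg_closed_field, field_prime_char}) tau_laurent set"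
  where "Jmod = laurent_over (Fbar TYPE('e))"

definition T_module ::
    "('f \<Rightarrow> ('e::finite, 'a::{alg_closed_field, field_prime_char}) tau_laurent)
      \<Rightarrow> ('f \<Rightarrow> ('e, 'a) tau_laurent) \<Rightarrow> (('e, 'a) tau_laurent \<Rightarrow> ('e, 'a) tau_laurent) set"
  where "T_module \<iota> \<phi> = tensor_hom Jmod Jmod \<iota> UNIV \<phi>"

definition End_J ::
    "('f \<Rightarrow> ('e::finite, 'a::{alg_closed_field, field_prime_char}) tau_laurent)
      \<Rightarrow> (('e, 'a) tau_laurent \<Rightarrow> ('e, 'a) tau_laurent) set"
  where "End_J \<iota> = tensor_hom Jmod Jmod \<iota> Jmod \<iota>"

definition D_units ::
    "('f \<Rightarrow> ('e::finite, 'a::{alg_closed_field, field_prime_char}) tau_laurent)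
      \<Rightarrow> (('e, 'a) tau_laurent \<Rightarrow> ('e, 'a) tau_laurent) set"
  where "D_units \<iota> = {g \<in> End_J \<iota>. \<exists>h\<in>End_J \<iota>.
    compose Jmod g h = (\<lambda>y\<in>Jmod. y) \<and> compose Jmod h g = (\<lambda>y\<in>Jmod. y)}"

definition D_iota ::
    "('f \<Rightarrow> ('e::finite, 'a::{alg_closed_field, field_prime_char}) tau_laurent) \<Rightarrow> ('e, 'a) tau_laurent set"
  where "D_iota \<iota> = {\<alpha> \<in> Jmod. \<forall>x. \<alpha> * \<iota> x = \<iota> x * \<alpha>}"

definition D_iota_units ::
    "('f \<Rightarrow> ('e::finite, 'a::{alg_closed_field, field_prime_char}) tau_laurent) \<Rightarrow> ('e, 'a) tau_laurent set"
  where "D_iota_units \<iota> = {\<alpha> \<in> D_iota \<iota>. \<exists>\<beta>\<in>D_iota \<iota>. \<alpha> * \<beta> = 1 \<and> \<beta> * \<alpha> = 1}"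

definition right_mult ::
    "('e::finite, 'a::{alg_closed_field, field_prime_char}) tau_laurent
      \<Rightarrow> ('e, 'a) tau_laurent \<Rightarrow> ('e, 'a) tau_laurent"
  where "right_mult u = (\<lambda>y\<in>Jmod. y * u)"

definition Y_iota ::
    "('f \<Rightarrow> ('e::finite, 'a::{alg_closed_field, field_prime_char}) tau_laurent)
      \<Rightarrow> ('f \<Rightarrow> ('e, 'a) tau_laurent) \<Rightarrow> ('e, 'a) tau_laurent set"
  where "Y_iota \<iota> \<phi> = {u. u \<noteq> 0 \<and> (\<forall>x. \<iota> x = u * \<phi> x * inverse u)}"

definition Gal :: "'a::field set \<Rightarrow> ('a \<Rightarrow> 'a) set"
  where "Gal K = {\<gamma> \<in> ring_iso ring_of_type_algebra ring_of_type_algebra. \<forall>x\<in>K. \<gamma> x = x}"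

definition Zhat :: "(nat \<Rightarrow> int) set"
  where "Zhat = {a \<in> (\<Pi>\<^sub>E n\<in>{0<..}. {0..<int n}). \<forall>m>0. \<forall>n>0. m dvd n \<longrightarrow> a n mod int m = a m}"

definition Zhat_of_int :: "int \<Rightarrow> nat \<Rightarrow> int"
  where "Zhat_of_int k = (\<lambda>n\<in>{0<..}. k mod int n)"

definition gal_ord :: "'e::finite itself \<Rightarrow> ('a::{alg_closed_field, field_prime_char} \<Rightarrow> 'a) \<Rightarrow> nat \<Rightarrow> int"
  where "gal_ord E \<gamma> = (THE a. a \<in> Zhat \<and>
    (\<forall>n>0. \<forall>x::'a. x ^ (q_num E TYPE('a) ^ n) = x \<longrightarrow> \<gamma> x = frob E (- a n) x))"

definition Weil :: "'e::finite itself \<Rightarrow> 'a::{alg_closed_field, field_prime_char} set \<Rightarrow> ('a \<Rightarrow> 'a) set"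
  where "Weil E K = {\<gamma> \<in> Gal K. gal_ord E \<gamma> \<in> range Zhat_of_int}"

definition gal_ord_int :: "'e::finite itself \<Rightarrow> ('a::{alg_closed_field, field_prime_char} \<Rightarrow> 'a) \<Rightarrow> int"
  where "gal_ord_int E \<gamma> = (THE k. Zhat_of_int k = gal_ord E \<gamma>)"

definition tau_map :: "('a::zero \<Rightarrow> 'a) \<Rightarrow> ('e, 'a) tau_laurent \<Rightarrow> ('e, 'a) tau_laurent"
  where "tau_map \<gamma> f = Abs_tau_laurent (\<lambda>n. \<gamma> (tau_nth f n))"

definition Weil_act_Y :: "('a::{alg_closed_field, field_prime_char} \<Rightarrow> 'a)
      \<Rightarrow> ('e::finite, 'a) tau_laurent \<Rightarrow> ('e, 'a) tau_laurent"
  where "Weil_act_Y \<gamma> u = tau powi gal_ord_int TYPE('e) \<gamma> * tau_map \<gamma> u"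

definition Weil_act_T :: "('a::{alg_closed_field, field_prime_char} \<Rightarrow> 'a)
      \<Rightarrow> (('e::finite, 'a) tau_laurent \<Rightarrow> ('e, 'a) tau_laurent) \<Rightarrow> ('e, 'a) tau_laurent \<Rightarrow> ('e, 'a) tau_laurent"
  where "Weil_act_T \<gamma> f = (\<lambda>y\<in>Jmod. tau_map \<gamma> (f (tau powi gal_ord_int TYPE('e) \<gamma> * y)))"

end

theory Submission
  imports Defs "HOL-Algebra.Multiplicative_Group"
begin

text \<open>
  A homomorphism from J to V is determined by the image of 1, and it is right multiplication by
  this element; compatibility with the F-structures is the equation defining \<open>Y_iota\<close>. For the
  equivariance, let k be the order of a Weil element \<open>\<gamma>\<close>. On every finite field \<open>\<gamma>\<close> is the
  \<open>- k\<close>-th power of the Frobenius, whereas conjugation by \<open>\<tau>\<close> to the power k applies its k-th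
  power to the coefficients, so \<open>y \<mapsto> \<tau>\<^sup>k \<gamma>\<^sub>\<tau>(y) \<tau>\<^sup>-\<^sup>k\<close> is the identity on J. That the order is well defined
  rests on the Galois theory of finite fields: a generator g of the unit group of the field
  with \<open>q\<^sup>n\<close> elements is a root of the product of the linear factors of all its Frobenius
  conjugates, whose coefficients are Frobenius-fixed, so every automorphism permutes these
  conjugates.
\<close>

section \<open>Finite fields\<close>

lemma frob_of_nat:
  "frob E (int n) (x::'a::{alg_closed_field, field_prime_char}) = x ^ (q_num E TYPE('a) ^ n)"
  by (simp add: frob_def)

lemma frob_minus:
  fixes x :: "'a::{alg_closed_field, field_prime_char}"
  shows "frob E i (- x) = - frob E i x"
  by (metis add.right_inverse frob_add frob_of_0 minus_unique)

lemma frob_inverse: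
  fixes x :: "'a::{alg_closed_field, field_prime_char}"
  shows "frob E i (inverse x) = inverse (frob E i x)"
  by (metis frob_mult frob_of_0 frob_of_1 inverse_unique inverse_zero right_inverse)

lemma frob_pow:
  fixes x :: "'a::{alg_closed_field, field_prime_char}"
  shows "frob E i (x ^ k) = frob E i x ^ k"
  by (induction k) (simp_all add: frob_mult)

text \<open>For n > 0 this is the subfield with q^n elements. Phrasing it through
  \<open>frob\<close> makes integer exponents, negative ones included, available. For n = 0 it is
  the whole field, hence the assumption n > 0 in later lemmas.\<close>

definition frob_fixed :: "'e::finite itself \<Rightarrow> nat \<Rightarrow> 'a::{alg_closed_field, field_prime_char} set"
  where "frob_fixed E n = {x. frob E (int n) x = x}"

lemma frob_fixed_iff:
  "x \<in> frob_fixed E n \<longleftrightarrow> x ^ (q_num E TYPE('a::{alg_closed_field, field_prime_char}) ^ n) = (x::'a)"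
  by (simp add: frob_fixed_def frob_of_nat)

lemma Fq_eq: "Fq E = frob_fixed E 1"
  by (auto simp: Fq_def frob_fixed_iff)

lemma frob_fixed_mult:
  assumes "x \<in> frob_fixed E n"
  shows "frob E (int n * k) x = x"
proof -
  have nat: "frob E (int n * int m) x = x" for m
  proof (induction m)
    case (Suc m)
    have "frob E (int n * int (Suc m)) x = frob E (int n) (frob E (int n * int m) x)"
      by (simp add: frob_frob algebra_simps)
    thus ?case using Suc assms by (simp add: frob_fixed_def)
  qed simp
  show ?thesis
  proof (cases "k \<ge> 0")
    case True
    thus ?thesis using nat[of "nat k"] by simp
  next
    case False
    \<comment> \<open>A negative multiple is reduced to the nonnegative case by first inserting the
      opposite power, which fixes x.\<close>
    have "frob E (int n * k) x = frob E (int n * k) (frob E (int n * int (nat (- k))) x)"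
      by (simp only: nat)
    also have "\<dots> = x" using False by (simp add: frob_frob)
    finally show ?thesis .
  qed
qed

lemma frob_fixed_dvd: "m dvd n \<Longrightarrow> frob_fixed E m \<subseteq> frob_fixed E n"
proof
  fix x assume "m dvd n" "x \<in> frob_fixed E m"
  thus "x \<in> frob_fixed E n" using frob_fixed_mult[of x E m] by (auto simp: frob_fixed_def elim!: dvdE)
qed

text \<open>The n-th Frobenius power is trivial on this field, so only the residue class of the
  exponent modulo n matters. This turns the components of a profinite integer into usable
  exponents.\<close>

lemma frob_fixed_mod:
  assumes "x \<in> frob_fixed E n"
  shows "frob E (k mod int n) x = frob E k x"
proof -
  have "frob E k x = frob E (k mod int n + int n * (k div int n)) x" by simp
  also have "\<dots> = frob E (k mod int n) x"
    by (simp only: frob_frob[symmetric] frob_fixed_mult[OF assms])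
  finally show ?thesis by simp
qed

lemma frob_fixed_frob: "x \<in> frob_fixed E n \<Longrightarrow> frob E k x \<in> frob_fixed E n"
  unfolding frob_fixed_def by (simp add: frob_frob) (metis add.commute frob_frob)

text \<open>The field is the root set of X^N - X with N = q^n. This polynomial splits over the
  algebraically closed field, and its derivative is -1 because the characteristic divides N, so its
  N roots are distinct.\<close>

lemma card_frob_fixed:
  fixes E :: "'e::finite itself"
  assumes "n > 0"
  shows "finite (frob_fixed E n :: 'a::{alg_closed_field, field_prime_char} set)"
    and "card (frob_fixed E n :: 'a set) = q_num E TYPE('a) ^ n"
proof -
  define N where "N = q_num E TYPE('a) ^ n"
  have N: "N > 1" unfolding N_def using q_num_gt_1[of E, where 'a='a] assms by (rule one_less_power)
  have N0: "of_nat N = (0::'a)" using assms by (simp add: N_def q_num_def)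
  define p :: "'a poly" where "p = monom 1 N - [:0, 1:]"
  have deg: "degree p = N" unfolding p_def diff_conv_add_uminus
    using N by (subst degree_add_eq_left) (simp_all add: degree_monom_eq)
  hence p0: "p \<noteq> 0" using N by auto
  have roots: "{x. poly p x = 0} = frob_fixed E n"
    by (auto simp: p_def poly_monom frob_fixed_iff N_def)
  have pd: "poly (pderiv p) x = - 1" for x
    using N0 by (simp add: p_def pderiv_diff pderiv_monom pderiv_pCons)
  have lc: "lead_coeff p = 1" using N unfolding deg by (simp add: p_def coeff_pCons split: nat.split)
  obtain A where A: "size A = N" "p = (\<Prod>x\<in>#A. [:-x, 1:])"
    using alg_closed_imp_factorization[OF p0] lc deg by auto
  \<comment> \<open>A root of multiplicity at least two would also be a root of the derivative,
    which takes the value -1 everywhere.\<close>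
  have "count A x \<le> 1" for x
  proof (rule ccontr)
    assume "\<not> count A x \<le> 1"
    then have "{#x, x#} \<subseteq># A" by (simp add: subseteq_mset_def)
    then obtain B where B: "A = {#x, x#} + B" by (auto simp: subset_mset.le_iff_add)
    have "p = [:-x, 1:] * ([:-x, 1:] * (\<Prod>x\<in>#B. [:-x, 1:]))" using A(2) B by simp
    hence "poly (pderiv p) x = 0" by (simp only: pderiv_mult) simp
    thus False using pd by simp
  qed
  hence "count A x = count (mset_set (set_mset A)) x" for x
    by (metis One_nat_def count_eq_zero_iff count_mset_set(1,3) finite_set_mset le_Suc_eq le_zero_eq)
  hence "A = mset_set (set_mset A)" by (rule multiset_eqI)
  hence "card (set_mset A) = N" using A(1) by (metis size_mset_set)
  moreover have "set_mset A = {x. poly p x = 0}"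
    by (auto simp: A(2) poly_prod_mset prod_mset_zero_iff)
  ultimately show "card (frob_fixed E n :: 'a set) = q_num E TYPE('a) ^ n" by (simp add: roots N_def)
  show "finite (frob_fixed E n :: 'a set)" using poly_roots_finite[OF p0] by (simp add: roots)
qed

text \<open>If the exponents differed modulo n, some Frobenius power c with 0 < c < n would be
  trivial on the field with q^n elements. That field would then lie in the smaller one with q^c
  elements.\<close>

lemma frob_eq_on_frob_fixed:
  fixes E :: "'e::finite itself"
  assumes "n > 0" "\<And>x::'a::{alg_closed_field, field_prime_char}. x \<in> frob_fixed E n \<Longrightarrow> frob E k x = frob E l x"
  shows "k mod int n = l mod int n"
proof (rule ccontr)
  assume ne: "k mod int n \<noteq> l mod int n"
  define c where "c = nat ((k - l) mod int n)"
  have c: "int c = (k - l) mod int n" using assms(1) by (simp add: c_def)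
  have "c \<noteq> 0"
  proof
    assume "c = 0"
    hence "int n dvd k - l" using c by auto
    thus False using ne by (simp add: mod_eq_dvd_iff)
  qed
  moreover have "int c < int n" unfolding c using assms(1) by simp
  ultimately have cn: "0 < c" "c < n" by auto
  have "frob_fixed E n \<subseteq> (frob_fixed E c :: 'a set)"
  proof
    fix x :: 'a assume x: "x \<in> frob_fixed E n"
    have "frob E (int c) x = frob E (- l) (frob E k x)"
      unfolding c by (simp add: frob_fixed_mod[OF x] frob_frob)
    also have "\<dots> = x" by (simp add: assms(2)[OF x] frob_frob)
    finally show "x \<in> frob_fixed E c" by (simp add: frob_fixed_def)
  qed
  from card_mono[OF _ this] have "q_num E TYPE('a) ^ n \<le> q_num E TYPE('a) ^ c"
    using card_frob_fixed[OF cn(1), of E, where 'a='a] card_frob_fixed[OF assms(1), of E, where 'a='a] by simp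
  thus False using power_strict_increasing[OF cn(2) q_num_gt_1[of E, where 'a='a]] by simp
qed

text \<open>The field is packaged as a record with restricted carrier so that the cyclicity of the
  unit group of a finite field applies to it.\<close>

lemma frob_fixed_field:
  fixes E :: "'e::finite itself"
  shows "field (ring_of_type_algebra\<lparr>carrier := frob_fixed E n :: 'a::{alg_closed_field, field_prime_char} set\<rparr>)"
proof -
  have "\<exists>y\<in>frob_fixed E n. x + y = 0" if "x \<in> frob_fixed E n" for x :: 'a
    using that by (intro bexI[of _ "- x"]) (auto simp: frob_fixed_def frob_minus)
  moreover have "\<exists>y\<in>frob_fixed E n. x * y = 1" if "x \<in> frob_fixed E n" "x \<noteq> 0" for x :: 'a
    using that by (intro bexI[of _ "inverse x"]) (auto simp: frob_fixed_def frob_inverse)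
  ultimately show ?thesis
    unfolding ring_of_type_algebra_def
    by unfold_locales (auto simp: algebra_simps Units_def frob_fixed_def frob_add frob_mult)
qed

lemma frob_fixed_generator:
  fixes E :: "'e::finite itself"
  assumes "n > 0"
  obtains g :: "'a::{alg_closed_field, field_prime_char}"
    where "g \<in> frob_fixed E n" "\<And>x. x \<in> frob_fixed E n \<Longrightarrow> x \<noteq> 0 \<Longrightarrow> \<exists>i::nat. x = g ^ i"
proof -
  let ?R = "ring_of_type_algebra\<lparr>carrier := frob_fixed E n :: 'a set\<rparr>"
  interpret field ?R by (rule frob_fixed_field)
  have pow: "x [^]\<^bsub>?R\<^esub> i = x ^ i" for x :: 'a and i :: nat
    by (induction i) (auto simp: nat_pow_def ring_of_type_algebra_def mult.commute)
  have "finite (carrier ?R)" using card_frob_fixed(1)[OF assms] by simp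
  then obtain g where g: "g \<in> carrier (Multiplicative_Group.mult_of ?R)" "carrier (Multiplicative_Group.mult_of ?R) = {g [^]\<^bsub>?R\<^esub> i |i::nat. i \<in> UNIV}"
    by (elim bexE[OF finite_field_mult_group_has_gen])
  have carrier: "carrier (Multiplicative_Group.mult_of ?R) = frob_fixed E n - {0}"
    by (simp add: ring_of_type_algebra_def Multiplicative_Group.carrier_mult_of)
  show ?thesis
  proof (rule that)
    show "g \<in> frob_fixed E n" using g(1) unfolding carrier by simp
    fix x :: 'a assume "x \<in> frob_fixed E n" "x \<noteq> 0"
    hence "x \<in> {g [^]\<^bsub>?R\<^esub> i |i::nat. i \<in> UNIV}" unfolding g(2)[symmetric] carrier by simp
    thus "\<exists>i::nat. x = g ^ i" by (auto simp: pow)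
  qed
qed

section \<open>Ring endomorphisms acting on the coefficients of polynomials\<close>

lemma map_poly_mult_hom:
  assumes "h 0 = 0" "\<And>x y. h (x + y) = h x + h y" "\<And>x y. h (x * y) = h x * h y"
  shows "map_poly h (p * q) = map_poly h p * map_poly h (q :: 'a::comm_ring_1 poly)"
proof (rule poly_eqI)
  fix n
  have s: "h (sum f A) = (\<Sum>x\<in>A. h (f x))" for f :: "nat \<Rightarrow> 'a" and A
    by (induction A rule: infinite_finite_induct) (auto simp: assms)
  show "coeff (map_poly h (p * q)) n = coeff (map_poly h p * map_poly h q) n"
    by (simp add: coeff_map_poly assms(1) coeff_mult s assms(3))
qed

lemma poly_map_poly_hom:
  fixes h :: "'a::comm_ring_1 \<Rightarrow> 'a"
  assumes "h 0 = 0" "\<And>x y. h (x + y) = h x + h y" "\<And>x y. h (x * y) = h x * h y"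
  shows "poly (map_poly h p) (h x) = h (poly p x)"
  by (induction p) (simp_all add: map_poly_pCons assms)

section \<open>Galois and Weil elements\<close>

lemma GalD:
  assumes "\<gamma> \<in> Gal K"
  shows "\<gamma> (x + y) = \<gamma> x + \<gamma> y" "\<gamma> (x * y) = \<gamma> x * \<gamma> y" "\<gamma> 1 = 1" "\<gamma> 0 = 0" "inj \<gamma>"
    "x \<in> K \<Longrightarrow> \<gamma> x = x"
proof -
  show a: "\<gamma> (x + y) = \<gamma> x + \<gamma> y" for x y
    using assms by (simp add: Gal_def ring_iso_def ring_hom_def ring_of_type_algebra_def)
  show "\<gamma> 0 = 0" using a[of 0 0] by (metis add.right_neutral add_left_cancel)
qed (use assms in \<open>simp_all add: Gal_def ring_iso_def ring_hom_def ring_of_type_algebra_def bij_betw_def\<close>)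

lemma Gal_power: "\<gamma> \<in> Gal K \<Longrightarrow> \<gamma> (x ^ n) = \<gamma> x ^ n"
  by (induction n) (simp_all add: GalD)

lemma Gal_frob:
  fixes \<gamma> :: "'a::{alg_closed_field, field_prime_char} \<Rightarrow> 'a"
  assumes "\<gamma> \<in> Gal K"
  shows "\<gamma> (frob E i x) = frob E i (\<gamma> x)"
  by (rule frob_eqI[where n = "nat \<bar>i\<bar>", symmetric]) (auto simp: Gal_power[OF assms, symmetric] frob_power)

lemma Gal_frob_fixed:
  fixes \<gamma> :: "'a::{alg_closed_field, field_prime_char} \<Rightarrow> 'a" and E :: "'e::finite itself"
  assumes \<gamma>: "\<gamma> \<in> Gal K" and "Fq E \<subseteq> K" "n > 0"
  obtains k where "\<And>x. x \<in> frob_fixed E n \<Longrightarrow> \<gamma> x = frob E k x"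
proof -
  obtain g :: 'a where g: "g \<in> frob_fixed E n" "\<And>x. x \<in> frob_fixed E n \<Longrightarrow> x \<noteq> 0 \<Longrightarrow> \<exists>i::nat. x = g ^ i"
    using frob_fixed_generator[OF assms(3)] by blast
  \<comment> \<open>The index set is left arbitrary so that applying the Frobenius to the
    coefficients becomes translation of S by one; the case needed is a full period {0..<n}.\<close>
  define P where "P S = (\<Prod>i\<in>S. [:- frob E i g, 1:])" for S
  have map: "map_poly (frob E 1) (P S) = P ((\<lambda>i. i + 1) ` S)" if "finite S" for S
    using that
  proof (induction S)
    case (insert i S)
    have "map_poly (frob E 1) (P (insert i S)) = map_poly (frob E 1) ([:- frob E i g, 1:] * P S)"
      using insert by (simp add: P_def)
    also have "\<dots> = map_poly (frob E 1) [:- frob E i g, 1:] * map_poly (frob E 1) (P S)"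
      by (rule map_poly_mult_hom) (simp_all add: frob_add frob_mult)
    also have "\<dots> = [:- frob E (i + 1) g, 1:] * P ((\<lambda>i. i + 1) ` S)"
      by (simp add: insert.IH map_poly_pCons frob_minus frob_frob add.commute)
    also have "\<dots> = P ((\<lambda>i. i + 1) ` insert i S)"
      using insert by (simp only: P_def image_insert) (subst prod.insert, auto)
    finally show ?case .
  qed (simp add: P_def map_poly_1)
  have shift: "(\<lambda>i. i + 1) ` {0..<int n} = {1..<int n + 1}" by auto
  \<comment> \<open>The translated period differs from the original one only in having the factor
    for index n instead of 0, and these factors agree because g is fixed by the n-th Frobenius
    power.\<close>
  have "P {1..<int n + 1} = P {1..<int n} * [:- frob E (int n) g, 1:]"
  proof -
    have "{1..<int n + 1} = insert (int n) {1..<int n}" using assms(3) by auto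
    thus ?thesis by (simp add: P_def mult.commute)
  qed
  also have "\<dots> = P {1..<int n} * [:- frob E 0 g, 1:]" using g by (simp add: frob_fixed_def)
  also have "\<dots> = P {0..<int n}"
  proof -
    have "{0..<int n} = insert 0 {1..<int n}" using assms(3) by auto
    thus ?thesis by (simp add: P_def mult.commute)
  qed
  finally have inv: "map_poly (frob E 1) (P {0..<int n}) = P {0..<int n}"
    by (simp add: map shift)
  have "frob E 1 (coeff (P {0..<int n}) i) = coeff (P {0..<int n}) i" for i
    by (subst (2) inv[symmetric]) (simp add: coeff_map_poly)
  \<comment> \<open>Frobenius-fixed coefficients lie in F_q, hence in K. So \<gamma> fixes the
    polynomial and sends its root g to one of its roots, which are the Frobenius conjugates of
    g.\<close>
  hence "coeff (P {0..<int n}) i \<in> K" for i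
    using assms(2) by (auto simp: Fq_eq frob_fixed_def)
  hence "map_poly \<gamma> (P {0..<int n}) = P {0..<int n}"
    by (intro poly_eqI) (simp add: coeff_map_poly GalD[OF \<gamma>])
  hence "poly (P {0..<int n}) (\<gamma> g) = \<gamma> (poly (P {0..<int n}) g)"
    by (metis poly_map_poly_hom GalD(1,2,4)[OF \<gamma>])
  also have "poly (P {0..<int n}) g = 0"
    using assms(3) by (auto simp: P_def poly_prod intro!: bexI[of _ 0])
  finally have "poly (P {0..<int n}) (\<gamma> g) = 0" by (simp add: GalD[OF \<gamma>])
  then obtain k where k: "\<gamma> g = frob E k g" by (auto simp: P_def poly_prod)
  have "\<gamma> x = frob E k x" if x: "x \<in> frob_fixed E n" for x
  proof (cases "x = 0")
    case False
    then obtain i where "x = g ^ i" using g(2)[OF x] by blast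
    thus ?thesis by (simp add: Gal_power[OF \<gamma>] k frob_pow)
  qed (simp add: GalD[OF \<gamma>])
  thus ?thesis by (rule that)
qed

text \<open>This justifies the definite description in \<open>gal_ord\<close>: on each finite field
  \<gamma> is a Frobenius power, and its exponent is unique modulo n. The minus sign reflects the
  geometric normalization of the Frobenius.\<close>

lemma gal_ord_correct:
  fixes \<gamma> :: "'a::{alg_closed_field, field_prime_char} \<Rightarrow> 'a" and E :: "'e::finite itself"
  assumes \<gamma>: "\<gamma> \<in> Gal K" and K: "Fq E \<subseteq> K"
  shows "gal_ord E \<gamma> \<in> Zhat" "n > 0 \<Longrightarrow> x \<in> frob_fixed E n \<Longrightarrow> \<gamma> x = frob E (- gal_ord E \<gamma> n) x"
proof -
  let ?P = "\<lambda>a. a \<in> Zhat \<and> (\<forall>n>0. \<forall>x::'a. x ^ (q_num E TYPE('a) ^ n) = x \<longrightarrow> \<gamma> x = frob E (- a n) x)"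
  have "\<exists>k. \<forall>x\<in>frob_fixed E n. \<gamma> x = frob E (- k) x" if "n > 0" for n
    using Gal_frob_fixed[OF \<gamma> K that] by (metis minus_minus)
  then obtain c where c: "\<And>n x. n > 0 \<Longrightarrow> x \<in> frob_fixed E n \<Longrightarrow> \<gamma> x = frob E (- c n) x" by metis
  \<comment> \<open>The chosen exponents are reduced to the representatives in {0..<n} that
    \<open>Zhat\<close> prescribes; restricting to positive n makes the family extensional.\<close>
  define a where "a = (\<lambda>n\<in>{0<..}. c n mod int n)"
  have uniq: "k mod int n = l mod int n"
    if "n > 0" "\<And>x. x \<in> frob_fixed E n \<Longrightarrow> \<gamma> x = frob E (- k) x"
      "\<And>x. x \<in> frob_fixed E n \<Longrightarrow> \<gamma> x = frob E (- l) x" for k l n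
  proof -
    have "(- k) mod int n = (- l) mod int n"
      using that by (intro frob_eq_on_frob_fixed[of n E, where 'a='a]) auto
    thus ?thesis by (metis minus_minus mod_minus_cong)
  qed
  have a: "\<gamma> x = frob E (- a n) x" if "n > 0" "x \<in> frob_fixed E n" for n x
  proof -
    have "frob E (- a n) x = frob E ((- a n) mod int n) x" by (simp only: frob_fixed_mod[OF that(2)])
    also have "(- a n) mod int n = (- c n) mod int n" using that(1) by (simp add: a_def mod_minus_eq)
    also have "frob E \<dots> x = frob E (- c n) x" by (rule frob_fixed_mod[OF that(2)])
    finally show ?thesis using c[OF that] by simp
  qed
  have "a \<in> Zhat"
    unfolding Zhat_def
  proof (intro CollectI conjI allI impI)
    show "a \<in> (\<Pi>\<^sub>E n\<in>{0<..}. {0..<int n})" by (auto simp: a_def)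
    fix m n :: nat assume mn: "m > 0" "n > 0" "m dvd n"
    \<comment> \<open>For m dividing n the smaller field lies in the larger one, so both exponents
      describe \<gamma> on the smaller field and uniqueness there applies.\<close>
    have "a n mod int m = a m mod int m"
      using mn frob_fixed_dvd[OF mn(3), of E, where 'a='a]
      by (intro uniq) (auto intro!: a)
    also have "a m mod int m = a m" using mn by (simp add: a_def)
    finally show "a n mod int m = a m" .
  qed
  have "\<exists>!a. ?P a"
  proof (rule ex1I[of _ a])
    show "?P a" using a \<open>a \<in> Zhat\<close> by (simp add: frob_fixed_iff)
    fix b assume b: "?P b"
    show "b = a"
    proof
      fix n
      show "b n = a n"
      proof (cases "n > 0")
        case True
        have "b n mod int n = a n mod int n"
          using b a[OF True] True by (intro uniq) (auto simp: frob_fixed_iff)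
        moreover have "b n \<in> {0..<int n}" "a n \<in> {0..<int n}"
          using b \<open>a \<in> Zhat\<close> True by (auto simp: Zhat_def PiE_iff)
        ultimately show ?thesis by simp
      next
        case False
        thus ?thesis using b \<open>a \<in> Zhat\<close> by (auto simp: Zhat_def PiE_iff extensional_def)
      qed
    qed
  qed
  from theI'[OF this] have "?P (gal_ord E \<gamma>)" unfolding gal_ord_def .
  thus "gal_ord E \<gamma> \<in> Zhat" "n > 0 \<Longrightarrow> x \<in> frob_fixed E n \<Longrightarrow> \<gamma> x = frob E (- gal_ord E \<gamma> n) x"
    by (simp_all add: frob_fixed_iff)
qed

lemma inj_Zhat_of_int: "inj Zhat_of_int"
proof (rule injI, rule ccontr)
  fix k l :: int assume kl: "Zhat_of_int k = Zhat_of_int l" "k \<noteq> l"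
  \<comment> \<open>A modulus larger than the distance of k and l, so that congruence forces
    equality.\<close>
  define n where "n = nat \<bar>k - l\<bar> + 1"
  from kl(1) have "k mod int n = l mod int n"
    by (auto simp: Zhat_of_int_def n_def dest!: fun_cong[of _ _ n])
  hence "int n dvd k - l" by (simp add: mod_eq_dvd_iff)
  hence "int n \<le> \<bar>k - l\<bar>" using kl(2) by (intro zdvd_imp_le) auto
  thus False by (simp add: n_def)
qed

text \<open>For a Weil element the n-th component of the order is the residue of one integer k
  modulo n. Hence the single exponent -k works on all finite fields at once.\<close>

lemma Weil_frob_fixed:
  fixes \<gamma> :: "'a::{alg_closed_field, field_prime_char} \<Rightarrow> 'a" and E :: "'e::finite itself"
  assumes "\<gamma> \<in> Weil E K" "Fq E \<subseteq> K" "n > 0" "x \<in> frob_fixed E n"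
  shows "\<gamma> x = frob E (- gal_ord_int E \<gamma>) x"
proof -
  have \<gamma>: "\<gamma> \<in> Gal K" using assms by (simp add: Weil_def)
  obtain k where k: "gal_ord E \<gamma> = Zhat_of_int k" using assms by (auto simp: Weil_def)
  hence "gal_ord_int E \<gamma> = k"
    unfolding gal_ord_int_def by (auto intro!: the_equality dest: injD[OF inj_Zhat_of_int])
  moreover have "\<gamma> x = frob E ((- (k mod int n)) mod int n) x"
    using gal_ord_correct(2)[OF \<gamma> assms(2-4)] assms(3)
    by (simp add: frob_fixed_mod[OF assms(4)] k Zhat_of_int_def)
  ultimately show ?thesis by (simp add: mod_minus_eq frob_fixed_mod[OF assms(4)])
qed

section \<open>Laurent series over the closure of the finite field\<close>

text \<open>An element algebraic over F_q has finitely many Frobenius iterates, since all are roots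
  of the same polynomial over F_q; a repetition among them puts it into a finite field. Conversely,
  the elements of a finite field are roots of X^N - X.\<close>

lemma Fbar_iff: "x \<in> Fbar E \<longleftrightarrow> (\<exists>n>0. x \<in> frob_fixed E n)"
  for x :: "'a::{alg_closed_field, field_prime_char}" and E :: "'e::finite itself"
proof -
  let ?R = "ring_of_type_algebra :: 'a ring"
  have sel: "carrier ?R = UNIV" "\<zero>\<^bsub>?R\<^esub> = 0" "\<one>\<^bsub>?R\<^esub> = 1"
    "y \<oplus>\<^bsub>?R\<^esub> z = y + z" "y \<otimes>\<^bsub>?R\<^esub> z = y * z" for y z :: 'a
    by (simp_all add: ring_of_type_algebra_def)
  interpret R: field ?R by (rule field_from_type_algebra)
  have sub: "subring (Fq E) ?R"
  proof (rule R.subringI)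
    fix y :: 'a assume "y \<in> Fq E"
    moreover have "\<ominus>\<^bsub>?R\<^esub> y = - y"
      by (rule R.sum_zero_eq_neg[symmetric]) (simp_all add: sel)
    ultimately show "\<ominus>\<^bsub>?R\<^esub> y \<in> Fq E" by (simp add: Fq_eq frob_fixed_def frob_minus)
  qed (auto simp: Fq_eq frob_fixed_def sel frob_add frob_mult)
  have pow: "y [^]\<^bsub>?R\<^esub> i = y ^ i" for y :: 'a and i :: nat
    by (induction i) (auto simp: nat_pow_def sel mult.commute)
  have Nil: "R.eval [] y = 0" for y by (simp add: sel)
  have Cons: "R.eval (c # p) y = c * y ^ length p + R.eval p y" for c p y
    by (simp add: pow sel)
  \<comment> \<open>Algebraic polynomials are coefficient lists with the leading coefficient first,
    whereas \<open>Poly\<close> expects the constant term first.\<close>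
  have eval: "R.eval p y = poly (Poly (rev p)) y" for p y
    by (induction p) (simp_all add: Nil Cons Poly_append poly_monom del: R.eval.simps)
  show ?thesis
  proof
    assume "x \<in> Fbar E"
    hence "(R.algebraic over Fq E) x" by (simp add: Fbar_def)
    moreover have "x \<in> carrier ?R" by (simp add: sel)
    ultimately obtain p where p: "p \<in> carrier (univ_poly ?R (Fq E))" "p \<noteq> []" "R.eval p x = 0"
      using R.algebraicE[OF sub] sel(2) by metis
    then obtain c p' where cp: "p = c # p'" by (cases p) auto
    have set: "set p \<subseteq> Fq E" "c \<noteq> 0"
      using p(1,2) cp by (auto simp: univ_poly_def polynomial_def sel)
    have "coeff (Poly (rev p)) (length p') \<noteq> 0"
      using set by (simp add: cp nth_default_def nth_append)
    hence nz: "Poly (rev p) \<noteq> 0" by (metis coeff_0)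
    have frob: "R.eval p (frob E 1 y) = frob E 1 (R.eval p y)" for y
      using set(1)
      by (induction p)
        (simp_all add: Nil Cons frob_add frob_mult frob_pow Fq_eq frob_fixed_def del: R.eval.simps)
    have "R.eval p (frob E (int i) x) = 0" for i
    proof (induction i)
      case (Suc i)
      have "frob E (int (Suc i)) x = frob E 1 (frob E (int i) x)" by (simp add: frob_frob)
      thus ?case using Suc frob[of "frob E (int i) x"] by (simp only: frob_of_0)
    qed (simp add: p(3))
    hence "range (\<lambda>i. frob E (int i) x) \<subseteq> {y. poly (Poly (rev p)) y = 0}" by (auto simp: eval)
    hence "finite (range (\<lambda>i. frob E (int i) x))"
      using poly_roots_finite[OF nz] by (rule finite_subset)
    hence "\<not> inj (\<lambda>i. frob E (int i) x)" using finite_imageD by blast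
    then obtain i j where "frob E (int i) x = frob E (int j) x" "i < j"
      by (metis linorder_inj_onI' )
    hence "frob E (- int i) (frob E (int i) x) = frob E (- int i) (frob E (int j) x)" "i < j" by simp_all
    hence "x \<in> frob_fixed E (j - i)" by (simp add: frob_frob frob_fixed_def of_nat_diff)
    thus "\<exists>n>0. x \<in> frob_fixed E n" using \<open>i < j\<close> by (intro exI[of _ "j - i"]) simp
  next
    assume "\<exists>n>0. x \<in> frob_fixed E n"
    then obtain n where n: "n > 0" "x \<in> frob_fixed E n" by blast
    define N where "N = q_num E TYPE('a) ^ n"
    have N: "N > 1" unfolding N_def using q_num_gt_1[of E, where 'a='a] n(1) by (rule one_less_power)
    \<comment> \<open>M counts the zero coefficients strictly between X^N and X in the list for X^N
      - X.\<close>
    then obtain M where M: "N = M + 2" by (metis Suc_1 Suc_leI le_Suc_ex add.commute)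
    define p where "p = (1::'a) # (replicate M \<zero>\<^bsub>?R\<^esub> @ [- 1, 0])"
    have "R.eval (replicate M \<zero>\<^bsub>?R\<^esub> @ [- 1, 0]) x = R.eval [- 1, 0] x"
      by (rule R.eval_replicate) (auto simp: sel)
    also have "\<dots> = - x" by (simp add: Nil Cons del: R.eval.simps)
    finally have "R.eval p x = x ^ N - x"
      by (simp add: p_def M Cons del: R.eval.simps)
    hence "R.eval p x = \<zero>\<^bsub>?R\<^esub>" using n(2) by (simp add: frob_fixed_iff N_def sel)
    moreover have "p \<in> carrier (univ_poly ?R (Fq E))"
      by (auto simp: univ_poly_def polynomial_def p_def sel Fq_eq frob_fixed_def frob_minus)
    ultimately have "(R.algebraic over Fq E) x"
      by (intro R.algebraicI[of p]) (simp_all add: p_def)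
    thus "x \<in> Fbar E" by (simp add: Fbar_def)
  qed
qed

lemma Fbar_common_frob_fixed:
  assumes "x \<in> Fbar E" "y \<in> Fbar E"
  obtains n where "n > 0" "x \<in> frob_fixed E n" "y \<in> frob_fixed E n"
proof -
  obtain m n where "m > 0" "x \<in> frob_fixed E m" "n > 0" "y \<in> frob_fixed E n"
    using assms by (auto simp: Fbar_iff)
  thus ?thesis
    using that[of "m * n"] frob_fixed_dvd[of m "m * n" E] frob_fixed_dvd[of n "m * n" E] by auto
qed

text \<open>Any two elements lie in a common finite field, on which a Frobenius power that is
  additive and multiplicative acts trivially.\<close>

lemma Fbar_closed:
  shows Fbar_0: "0 \<in> Fbar E" and Fbar_1: "1 \<in> Fbar E"
    and Fbar_frob: "x \<in> Fbar E \<Longrightarrow> frob E i x \<in> Fbar E"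
    and Fbar_add: "x \<in> Fbar E \<Longrightarrow> y \<in> Fbar E \<Longrightarrow> x + y \<in> Fbar E"
    and Fbar_mult: "x \<in> Fbar E \<Longrightarrow> y \<in> Fbar E \<Longrightarrow> x * y \<in> Fbar E"
proof -
  show "0 \<in> Fbar E" "1 \<in> Fbar E" by (auto simp: Fbar_iff frob_fixed_def)
  show "frob E i x \<in> Fbar E" if "x \<in> Fbar E"
    using that by (auto simp: Fbar_iff intro: frob_fixed_frob)
  show "x + y \<in> Fbar E" "x * y \<in> Fbar E" if "x \<in> Fbar E" "y \<in> Fbar E"
  proof -
    from that obtain n where "n > 0" "x \<in> frob_fixed E n" "y \<in> frob_fixed E n"
      by (rule Fbar_common_frob_fixed)
    thus "x + y \<in> Fbar E" "x * y \<in> Fbar E"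
      by (auto simp: Fbar_iff frob_fixed_def frob_add frob_mult)
  qed
qed

lemma Jmod_add: "f \<in> Jmod \<Longrightarrow> g \<in> Jmod \<Longrightarrow> f + g \<in> Jmod"
  by (simp add: Jmod_def laurent_over_def Fbar_add)

lemma Jmod_0: "0 \<in> Jmod"
  by (simp add: Jmod_def laurent_over_def Fbar_0)

lemma Jmod_1: "1 \<in> Jmod"
  by (simp add: Jmod_def laurent_over_def Fbar_0 Fbar_1)

lemma Jmod_monom: "a \<in> Fbar TYPE('e) \<Longrightarrow> (tau_monom a n :: ('e::finite, _) tau_laurent) \<in> Jmod"
  by (simp add: Jmod_def laurent_over_def Fbar_0)

lemma Jmod_mult:
  fixes f g :: "('e::finite, 'a::{alg_closed_field, field_prime_char}) tau_laurent"
  assumes "f \<in> Jmod" "g \<in> Jmod"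
  shows "f * g \<in> Jmod"
proof -
  have sum: "sum h A \<in> Fbar TYPE('e)" if "\<And>i. i \<in> A \<Longrightarrow> h i \<in> Fbar TYPE('e)" for h :: "int \<Rightarrow> 'a" and A
    using that by (induction A rule: infinite_finite_induct) (auto simp: Fbar_0 Fbar_add)
  show ?thesis
    using assms by (auto simp: Jmod_def laurent_over_def tau_nth_times intro!: sum Fbar_mult Fbar_frob)
qed

text \<open>The index of a coefficient is the exponent of the inverse of \<tau>, hence the change of
  sign.\<close>

lemma tau_powi: "tau powi k = (tau_monom 1 (- k) :: ('e::finite, 'a::{alg_closed_field, field_prime_char}) tau_laurent)"
proof -
  have pow: "tau_monom 1 m ^ n = (tau_monom 1 (m * int n) :: ('e, 'a) tau_laurent)" for m n
    by (induction n) (simp_all add: tau_monom_mult algebra_simps, rule tau_eqI, simp)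
  show ?thesis
    unfolding power_int_def inverse_tau by (simp add: tau_def pow)
qed

lemma tau_nth_monom_mult:
  fixes f :: "('e::finite, 'a::{alg_closed_field, field_prime_char}) tau_laurent"
  shows "tau_nth (tau_monom a m * f) n = a * frob TYPE('e) (- m) (tau_nth f (n - m))"
proof -
  have "tau_nth (tau_monom a m * f) n =
      (\<Sum>i\<in>{m}. tau_nth (tau_monom a m :: ('e, 'a) tau_laurent) i * frob TYPE('e) (- i) (tau_nth f (n - i)))"
    unfolding tau_nth_times by (rule sum.mono_neutral_left) auto
  thus ?thesis by simp
qed

lemma tau_nth_mult_monom:
  fixes f :: "('e::finite, 'a::{alg_closed_field, field_prime_char}) tau_laurent"
  shows "tau_nth (f * tau_monom a m) n = tau_nth f (n - m) * frob TYPE('e) (m - n) a"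
proof -
  have "tau_nth (f * tau_monom a m) n =
      (\<Sum>i\<in>{n - m}. tau_nth f i * frob TYPE('e) (- i) (tau_nth (tau_monom a m :: ('e, 'a) tau_laurent) (n - i)))"
    unfolding tau_nth_times by (rule sum.mono_neutral_left) auto
  thus ?thesis by simp
qed

section \<open>Coefficientwise automorphisms\<close>

lemma tau_nth_tau_map:
  assumes "\<gamma> 0 = 0"
  shows "tau_nth (tau_map \<gamma> f) n = \<gamma> (tau_nth f n)"
proof -
  obtain N where "\<forall>n<N. tau_nth f n = 0" using tau_bound by blast
  hence "\<forall>n<N. \<gamma> (tau_nth f n) = 0" using assms by simp
  thus ?thesis unfolding tau_map_def by (subst Abs_tau_laurent_inverse) auto
qed

lemma tau_map_mult:
  fixes f g :: "('e::finite, 'a::{alg_closed_field, field_prime_char}) tau_laurent"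
  assumes \<gamma>: "\<gamma> \<in> Gal K"
  shows "tau_map \<gamma> (f * g) = tau_map \<gamma> f * tau_map \<gamma> g"
proof (rule tau_eqI)
  fix n
  note nth = tau_nth_tau_map[of \<gamma>, OF GalD(4)[OF \<gamma>]]
  have sum: "\<gamma> (sum h A) = (\<Sum>i\<in>A. \<gamma> (h i))" for h :: "int \<Rightarrow> 'a" and A
    by (induction A rule: infinite_finite_induct) (auto simp: GalD[OF \<gamma>])
  \<comment> \<open>The sum defining a product runs over the nonzero coefficients, so \<gamma> has
    to preserve the supports.\<close>
  have "\<gamma> c = 0 \<longleftrightarrow> c = 0" for c using GalD(4,5)[OF \<gamma>] by (metis injD)
  thus "tau_nth (tau_map \<gamma> (f * g)) n = tau_nth (tau_map \<gamma> f * tau_map \<gamma> g) n"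
    by (simp add: nth tau_nth_times sum GalD(2)[OF \<gamma>] Gal_frob[OF \<gamma>])
qed

lemma tau_map_fixed:
  assumes "\<gamma> 0 = 0" "f \<in> laurent_over K" "\<And>x. x \<in> K \<Longrightarrow> \<gamma> x = x"
  shows "tau_map \<gamma> f = f"
  using assms by (intro tau_eqI) (simp add: tau_nth_tau_map laurent_over_def)

lemma tau_map_tau_powi:
  fixes \<gamma> :: "'a::{alg_closed_field, field_prime_char} \<Rightarrow> 'a"
  assumes "\<gamma> \<in> Gal K"
  shows "tau_map \<gamma> (tau powi k) = (tau powi k :: ('e::finite, 'a) tau_laurent)"
  by (intro tau_eqI) (simp add: tau_nth_tau_map tau_powi GalD[OF assms])

text \<open>With k the order, the left factor shifts the series and applies the k-th Frobenius
  power, which cancels the effect of \<gamma> on coefficients algebraic over F_q. Right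
  multiplication by the same power of \<tau> only shifts.\<close>

lemma Weil_tau_map_Jmod:
  fixes y :: "('e::finite, 'a::{alg_closed_field, field_prime_char}) tau_laurent"
  assumes "\<gamma> \<in> Weil TYPE('e) K" "Fq TYPE('e) \<subseteq> K" "y \<in> Jmod"
  shows "tau powi gal_ord_int TYPE('e) \<gamma> * tau_map \<gamma> y = y * tau powi gal_ord_int TYPE('e) \<gamma>"
proof (rule tau_eqI)
  fix n
  have \<gamma>: "\<gamma> \<in> Gal K" using assms(1) by (simp add: Weil_def)
  have "\<gamma> x = frob TYPE('e) (- gal_ord_int TYPE('e) \<gamma>) x" if "x \<in> Fbar TYPE('e)" for x
    using that Weil_frob_fixed[OF assms(1,2)] by (auto simp: Fbar_iff)
  thus "tau_nth (tau powi gal_ord_int TYPE('e) \<gamma> * tau_map \<gamma> y) n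
      = tau_nth (y * tau powi gal_ord_int TYPE('e) \<gamma>) n"
    using assms(3)
    by (simp add: tau_powi tau_nth_monom_mult tau_nth_mult_monom tau_nth_tau_map GalD[OF \<gamma>]
        Jmod_def laurent_over_def frob_frob)
qed

section \<open>Right multiplications\<close>

lemma continuous_alg_hom_laurent_over:
  "continuous_alg_hom j v L \<psi> \<Longrightarrow> \<psi> x \<in> laurent_over L"
proof -
  assume "continuous_alg_hom j v L \<psi>"
  hence "continuous_map (val_topology v) (subtopology (val_topology tau_val) (laurent_over L)) \<psi>"
    by (simp add: continuous_alg_hom_def)
  moreover have "openin (val_topology v) UNIV" by (simp add: openin_val_topology)
  hence "topspace (val_topology v) = UNIV" using openin_subset by blast
  ultimately show ?thesis by (auto simp: continuous_map_def)
qed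

lemma continuous_alg_hom_1:
  "continuous_alg_hom j v L \<psi> \<Longrightarrow> \<psi> 1 = 1"
  by (simp add: continuous_alg_hom_def ring_hom_def ring_of_type_algebra_def)

text \<open>Clearing the inverse gives the intertwining relation, which is the form that
  homomorphisms of modules produce.\<close>

lemma Y_iota_iff: "u \<in> Y_iota \<iota> \<phi> \<longleftrightarrow> u \<noteq> 0 \<and> (\<forall>x. \<iota> x * u = u * \<phi> x)"
proof -
  have "\<iota> x = u * \<phi> x * inverse u \<longleftrightarrow> \<iota> x * u = u * \<phi> x" if "u \<noteq> 0" for x
  proof
    assume "\<iota> x * u = u * \<phi> x"
    hence "u * \<phi> x * inverse u = \<iota> x * (u * inverse u)" by (simp only: mult.assoc[symmetric])
    thus "\<iota> x = u * \<phi> x * inverse u" using that by simp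
  qed (use that in \<open>simp add: mult.assoc\<close>)
  thus ?thesis by (auto simp: Y_iota_def)
qed

lemma tensor_act_mult:
  assumes "\<And>x. \<iota> x * u = u * \<phi> x"
  shows "tensor_act \<iota> t y * u = tensor_act \<phi> t (y * u)"
  unfolding tensor_act_def by (induction t) (auto simp: distrib_right mult.assoc assms)

lemma tensor_act_closed:
  assumes "\<And>x. \<iota> x \<in> Jmod" "t \<in> lists (Jmod \<times> UNIV)" "y \<in> Jmod"
  shows "tensor_act \<iota> t y \<in> Jmod"
  using assms(2) unfolding tensor_act_def
  by (induction t) (auto intro!: Jmod_0 Jmod_add Jmod_mult assms)

text \<open>The target N is kept general to cover both T(V), with the whole skew field as target,
  and the endomorphisms of J.\<close>

lemma right_mult_tensor_hom:
  assumes "\<And>x. \<iota> x \<in> Jmod" "\<And>x. \<iota> x * u = u * \<phi> x" "\<And>y. y \<in> Jmod \<Longrightarrow> y * u \<in> N"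
  shows "right_mult u \<in> tensor_hom Jmod Jmod \<iota> N \<phi>"
  unfolding tensor_hom_def right_mult_def using assms
  by (auto simp: Jmod_add distrib_right tensor_act_closed tensor_act_mult)

text \<open>Linearity is evaluated at 1 on two pure tensors: y \<otimes> 1 gives f as a right
  multiplication, and 1 \<otimes> x then gives the intertwining relation for
  \<open>f 1\<close>.\<close>

lemma T_module_right_mult:
  assumes "\<And>x. \<iota> x \<in> Jmod" "\<iota> 1 = 1" "\<phi> 1 = 1" "f \<in> T_module \<iota> \<phi>"
  shows "f = right_mult (f 1)" "\<iota> x * f 1 = f 1 * \<phi> x"
proof -
  have f: "f \<in> extensional Jmod"
    "\<And>t y. t \<in> lists (Jmod \<times> UNIV) \<Longrightarrow> y \<in> Jmod \<Longrightarrow> f (tensor_act \<iota> t y) = tensor_act \<phi> t (f y)"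
    using assms(4) by (auto simp: T_module_def tensor_hom_def PiE_def)
  have mult: "f y = y * f 1" if "y \<in> Jmod" for y
    using f(2)[of "[(y, 1)]" 1] that by (simp add: tensor_act_def Jmod_1 assms)
  show "f = right_mult (f 1)"
    using f(1) mult by (auto simp: right_mult_def fun_eq_iff extensional_def)
  show "\<iota> x * f 1 = f 1 * \<phi> x"
    using f(2)[of "[(1, x)]" 1] mult[OF assms(1)[of x]] by (simp add: tensor_act_def Jmod_1)
qed

lemma right_mult_inj: "right_mult u = right_mult w \<Longrightarrow> u = w"
  by (drule fun_cong[of _ _ 1]) (simp add: right_mult_def Jmod_1)

lemma bij_betw_right_mult:
  fixes \<iota> \<phi> :: "'f::field \<Rightarrow> ('e::finite, 'a::{alg_closed_field, field_prime_char}) tau_laurent"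
  assumes "\<And>x. \<iota> x \<in> Jmod" "\<iota> 1 = 1" "\<phi> 1 = 1"
  shows "bij_betw right_mult (Y_iota \<iota> \<phi>) (T_module \<iota> \<phi> - {\<lambda>y\<in>Jmod. 0})"
proof -
  \<comment> \<open>The zero homomorphism is right multiplication by 0, so removing it matches the
    condition that u be nonzero.\<close>
  have zero: "right_mult 0 = (\<lambda>y\<in>Jmod. 0 :: ('e, 'a) tau_laurent)" by (simp add: right_mult_def)
  show ?thesis
    unfolding bij_betw_def zero[symmetric]
  proof (intro conjI inj_onI subset_antisym subsetI)
    fix f assume "f \<in> right_mult ` Y_iota \<iota> \<phi>"
    then obtain u where "f = right_mult u" "u \<noteq> 0" "\<And>x. \<iota> x * u = u * \<phi> x"
      by (auto simp: Y_iota_iff)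
    thus "f \<in> T_module \<iota> \<phi> - {right_mult 0}"
      using right_mult_tensor_hom[of \<iota> u \<phi> UNIV] assms(1) by (auto simp: T_module_def dest: right_mult_inj)
  next
    fix f assume f: "f \<in> T_module \<iota> \<phi> - {right_mult 0}"
    hence "f \<in> T_module \<iota> \<phi>" by simp
    note fD = T_module_right_mult[OF assms this]
    from fD(1) f have "f 1 \<noteq> 0" by auto
    hence "f 1 \<in> Y_iota \<iota> \<phi>" using fD(2) by (simp add: Y_iota_iff)
    thus "f \<in> right_mult ` Y_iota \<iota> \<phi>" using fD(1) by blast
  qed (rule right_mult_inj)
qed

section \<open>Equivariance under the Weil group and the units of the endomorphism ring\<close>

lemma Weil_act_equivariant:
  fixes \<iota> \<phi> :: "'f \<Rightarrow> ('e::finite, 'a::{alg_closed_field, field_prime_char}) tau_laurent"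
  assumes \<iota>: "\<And>x. \<iota> x \<in> Jmod" and \<phi>: "\<And>x. \<phi> x \<in> laurent_over K" and K: "Fq TYPE('e) \<subseteq> K"
    and W: "\<gamma> \<in> Weil TYPE('e) K" and u: "u \<in> Y_iota \<iota> \<phi>"
  shows "Weil_act_Y \<gamma> u \<in> Y_iota \<iota> \<phi>" "right_mult (Weil_act_Y \<gamma> u) = Weil_act_T \<gamma> (right_mult u)"
proof -
  let ?t = "tau powi gal_ord_int TYPE('e) \<gamma> :: ('e, 'a) tau_laurent"
  have \<gamma>: "\<gamma> \<in> Gal K" using W by (simp add: Weil_def)
  note nth = tau_nth_tau_map[of \<gamma>, OF GalD(4)[OF \<gamma>]]
  have t: "?t \<in> Jmod" by (simp add: tau_powi Jmod_monom Fbar_1)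
  \<comment> \<open>The semilinear operator w \<mapsto> \<open>?t * tau_map \<gamma> w\<close> is
    thus left linear over J. This yields the intertwining relation as well as the
    equivariance.\<close>
  have comm: "?t * (tau_map \<gamma> y * w) = y * (?t * w)" if "y \<in> Jmod" for y w
    using Weil_tau_map_Jmod[OF W K that] by (simp add: mult.assoc[symmetric])
  have "tau_map \<gamma> u \<noteq> 0"
  proof
    assume "tau_map \<gamma> u = 0"
    hence "\<gamma> (tau_nth u n) = \<gamma> 0" for n by (simp add: nth[symmetric] GalD(4)[OF \<gamma>])
    hence "u = 0" using GalD(5)[OF \<gamma>] by (intro tau_eqI) (simp add: inj_eq)
    thus False using u by (simp add: Y_iota_iff)
  qed
  moreover have "?t \<noteq> 0"
  proof
    assume "?t = 0"
    hence "tau_nth ?t (- gal_ord_int TYPE('e) \<gamma>) = 0" by (simp only: tau_nth_simps)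
    thus False by (simp add: tau_powi)
  qed
  moreover have "\<iota> x * (?t * tau_map \<gamma> u) = ?t * tau_map \<gamma> u * \<phi> x" for x
  proof -
    have "\<iota> x * (?t * tau_map \<gamma> u) = ?t * tau_map \<gamma> (\<iota> x * u)"
      by (simp add: tau_map_mult[OF \<gamma>] comm[OF \<iota>])
    also have "\<iota> x * u = u * \<phi> x" using u by (simp add: Y_iota_iff)
    also have "tau_map \<gamma> (u * \<phi> x) = tau_map \<gamma> u * \<phi> x"
      by (simp add: tau_map_mult[OF \<gamma>] tau_map_fixed[OF GalD(4)[OF \<gamma>] \<phi> GalD(6)[OF \<gamma>]])
    finally show ?thesis by (simp add: mult.assoc)
  qed
  ultimately show "Weil_act_Y \<gamma> u \<in> Y_iota \<iota> \<phi>" by (simp add: Weil_act_Y_def Y_iota_iff)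
  show "right_mult (Weil_act_Y \<gamma> u) = Weil_act_T \<gamma> (right_mult u)"
    \<comment> \<open>In \<open>Weil_act_T\<close> the power of \<tau> has coefficients 0 and 1 and
      is fixed by \<gamma>; moving y to the left of it gives right multiplication by
      \<open>Weil_act_Y \<gamma> u\<close>.\<close>
    by (auto simp: right_mult_def Weil_act_Y_def Weil_act_T_def fun_eq_iff Jmod_mult t
        tau_map_mult[OF \<gamma>] tau_map_tau_powi[OF \<gamma>] comm mult.assoc)
qed

text \<open>Right multiplications compose in reverse order. Hence the left action on u becomes
  precomposition, and the identification of D with centralizer elements passes to the opposite
  ring.\<close>

lemma right_mult_mult:
  assumes "\<alpha> \<in> Jmod"
  shows "right_mult (\<alpha> * u) = compose Jmod (right_mult u) (right_mult \<alpha>)"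
  using assms by (auto simp: right_mult_def compose_def Jmod_mult mult.assoc fun_eq_iff)

lemma D_iota_units_equivariant:
  assumes \<iota>: "\<And>x. \<iota> x \<in> Jmod" and \<alpha>: "\<alpha> \<in> D_iota_units \<iota>" and u: "u \<in> Y_iota \<iota> \<phi>"
  shows "\<alpha> * u \<in> Y_iota \<iota> \<phi>" "right_mult \<alpha> \<in> D_units \<iota>"
    "right_mult (\<alpha> * u) = compose Jmod (right_mult u) (right_mult \<alpha>)"
proof -
  obtain \<beta> where D: "\<alpha> \<in> D_iota \<iota>" "\<beta> \<in> D_iota \<iota>" and inv: "\<alpha> * \<beta> = 1" "\<beta> * \<alpha> = 1"
    using \<alpha> by (auto simp: D_iota_units_def)
  have \<alpha>0: "\<alpha> \<noteq> 0" using inv(1) by auto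
  have "\<iota> x * (\<alpha> * u) = \<alpha> * u * \<phi> x" for x
    using D(1) u by (simp add: D_iota_def Y_iota_iff) (metis mult.assoc)
  thus "\<alpha> * u \<in> Y_iota \<iota> \<phi>" using \<alpha>0 u by (simp add: Y_iota_iff)
  have J: "\<alpha> \<in> Jmod" "\<beta> \<in> Jmod" using D by (auto simp: D_iota_def)
  have End: "right_mult \<delta> \<in> End_J \<iota>" if "\<delta> \<in> D_iota \<iota>" for \<delta>
    unfolding End_J_def using that \<iota> by (intro right_mult_tensor_hom) (auto simp: D_iota_def Jmod_mult)
  have "right_mult 1 = (\<lambda>y\<in>Jmod. y)" by (simp add: right_mult_def)
  \<comment> \<open>The inverse endomorphism is right multiplication by the inverse \<beta>, which
    again centralizes the image of \<iota>.\<close>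
  thus "right_mult \<alpha> \<in> D_units \<iota>"
    unfolding D_units_def using End[OF D(1)] End[OF D(2)]
    by (auto intro!: bexI[of _ "right_mult \<beta>"] simp: right_mult_mult[OF J(1), symmetric] right_mult_mult[OF J(2), symmetric] inv)
  show "right_mult (\<alpha> * u) = compose Jmod (right_mult u) (right_mult \<alpha>)"
    by (rule right_mult_mult[OF J(1)])
qed

theorem theorem7p19:
  fixes K :: "'a::{alg_closed_field, field_prime_char} set"
    and v :: "'f::field \<Rightarrow> int" and j :: "'a \<Rightarrow> 'f" and z :: 'f and r d :: nat
    and \<iota> \<phi> :: "'f \<Rightarrow> ('e::finite, 'a) tau_laurent"
  assumes "local_field_over TYPE('e) j v"
    and "uniformizer v z" and "residue_degree TYPE('e) j v d"
    and "algebraic_closure (ring_of_type_algebra :: 'a ring) K"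
    and "Fq TYPE('e) \<subseteq> K" and "perfect_in K"
    and "r > 0"
    and "continuous_alg_hom j v (Fbar TYPE('e)) \<iota>" and "continuous_alg_hom j v K \<phi>"
    and "tau_val (\<iota> z) = int (r * d)" and "tau_val (\<phi> z) = int (r * d)"
  shows "bij_betw right_mult (Y_iota \<iota> \<phi>) (T_module \<iota> \<phi> - {\<lambda>y\<in>Jmod. 0})
    \<and> (\<forall>\<gamma>\<in>Weil TYPE('e) K. \<forall>u\<in>Y_iota \<iota> \<phi>.
      Weil_act_Y \<gamma> u \<in> Y_iota \<iota> \<phi> \<and> right_mult (Weil_act_Y \<gamma> u) = Weil_act_T \<gamma> (right_mult u))
    \<and> (\<forall>\<alpha>\<in>D_iota_units \<iota>. \<forall>u\<in>Y_iota \<iota> \<phi>.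
      \<alpha> * u \<in> Y_iota \<iota> \<phi> \<and> right_mult \<alpha> \<in> D_units \<iota> \<and>
      right_mult (\<alpha> * u) = compose Jmod (right_mult u) (right_mult \<alpha>))"
proof -
  have \<iota>: "\<iota> x \<in> Jmod" for x
    unfolding Jmod_def using assms(8) by (rule continuous_alg_hom_laurent_over)
  have \<phi>: "\<phi> x \<in> laurent_over K" for x
    using assms(9) by (rule continuous_alg_hom_laurent_over)
  have "bij_betw right_mult (Y_iota \<iota> \<phi>) (T_module \<iota> \<phi> - {\<lambda>y\<in>Jmod. 0})"
    using \<iota> continuous_alg_hom_1[OF assms(8)] continuous_alg_hom_1[OF assms(9)]
    by (rule bij_betw_right_mult)
  thus ?thesis
    using Weil_act_equivariant[of \<iota> \<phi> K, OF \<iota> \<phi> assms(5)] D_iota_units_equivariant[of \<iota>, OF \<iota>] by blast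
qed

end
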